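(* Let $n\ge2$ be an integer and let $$\mathcal{G}_2:=\{A\subseteq n^{<\omega} : \exists s_1,s_2\in n^{<\omega}\ \ A^\infty=\{s_1,s_2\}^\infty\}.$$ Then $\mathcal{G}_2$, as a subset of $2^{n^{<\omega}}$, is in $\check D_\omega(\mathbf{\Sigma}^0_1)\setminus D_\omega(\mathbf{\Sigma}^0_1)$. In particular, $\mathcal{G}_2$ is $\check D_\omega(\mathbf{\Sigma}^0_1)$-complete.
   Context: $n=\{0,\dots,n-1\}$ is a finite alphabet, $n^{<\omega}$ is the set of finite words over it. For $A\subseteq n^{<\omega}$, $A^\infty:=\{a_0a_1a_2\ldots\in n^\omega : \forall i\in\omega\ a_i\in A\}$. Subsets of $n^{<\omega}$ are identified with points of the compact space $2^{n^{<\omega}}$ with the product topology. $D_\omega(\mathbf{\Sigma}^0_1)$ is the class of sets of the form $\bigcup_{k<\omega,\ k\text{ odd}}\big(V_k\setminus\bigcup_{j<k}V_j\big)$ where $(V_k)_{k<\omega}$ is an increasing sequence of open sets; $\check D_\omega(\mathbf{\Sigma}^0_1)$ is the class of complements of such sets. For a class $\Gamma$, a set $C\subseteq X$ ($X$ a zero-dimensional Polish space) is $\Gamma$-complete if $C\in\Gamma(X)$ and every $\Gamma$ subset of every zero-dimensional Polish space $Y$ is the preimage of $C$ under some continuous map $Y\to X$. *)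

theory Defs
  imports "HOL-Analysis.Analysis"
begin

text \<open>The letters of the alphabet \<open>n\<close> are the naturals below \<open>n\<close>, so \<open>lists {..<n}\<close> is the set of
  all finite words, including the empty one.\<close>

text \<open>The infinite word \<open>x\<close> is \<open>a 0 @ a 1 @ a 2 @ \<dots>\<close>. Some of the factors may be empty,
  but the second conjunct requires that the concatenation is infinite.\<close>

definition is_inf_concat :: "(nat \<Rightarrow> 'a list) \<Rightarrow> (nat \<Rightarrow> 'a) \<Rightarrow> bool" where
  "is_inf_concat a x \<longleftrightarrow>
     (\<forall>k. map x [0..<length (concat (map a [0..<k]))] = concat (map a [0..<k])) \<and>
     (\<forall>m. \<exists>k. m \<le> length (concat (map a [0..<k])))"

definition omega_power :: "'a list set \<Rightarrow> (nat \<Rightarrow> 'a) set" where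
  "omega_power A = {x. \<exists>a. (\<forall>i. a i \<in> A) \<and> is_inf_concat a x}"

definition G2 :: "nat \<Rightarrow> nat list set set" where
  "G2 n = {A. A \<subseteq> lists {..<n} \<and>
     (\<exists>s1 \<in> lists {..<n}. \<exists>s2 \<in> lists {..<n}. omega_power A = omega_power {s1, s2})}"

text \<open>The power set of \<open>I\<close>, identified with the product space \<open>2\<close> to the power \<open>I\<close> through
  characteristic functions.\<close>

definition powerset_topology :: "'a set \<Rightarrow> 'a set topology" where
  "powerset_topology I =
     pullback_topology (Pow I) (\<lambda>A. \<lambda>s\<in>I. s \<in> A)
       (product_topology (\<lambda>_. discrete_topology (UNIV :: bool set)) I)"

lemma topspace_powerset_topology [simp]: "topspace (powerset_topology I) = Pow I"
  by (auto simp: powerset_topology_def topspace_pullback_topology)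

definition D_omega :: "'a topology \<Rightarrow> 'a set set" where
  "D_omega X = {\<Union>k \<in> {k. odd k}. V k - (\<Union>j<k. V j) | V :: nat \<Rightarrow> 'a set.
     incseq V \<and> (\<forall>k. openin X (V k))}"

definition co_D_omega :: "'a topology \<Rightarrow> 'a set set" where
  "co_D_omega X = {topspace X - S | S. S \<in> D_omega X}"

definition zero_dim_polish :: "'a topology \<Rightarrow> bool" where
  "zero_dim_polish X \<longleftrightarrow> completely_metrizable_space X \<and> separable_space X \<and> X dim_le 0"

text \<open>A class assigns to every space a family of subsets of it. An argument of a definition
  is not polymorphic, so the class is passed twice, as \<open>\<Gamma>\<close> for spaces over the type of \<open>X\<close> and as
  \<open>\<Gamma>'\<close> for the spaces \<open>Y\<close> over a type \<open>'b\<close>. A theorem in which \<open>'b\<close> remains a type variable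
  covers spaces \<open>Y\<close> over all types.\<close>

definition class_complete ::
  "('a topology \<Rightarrow> 'a set set) \<Rightarrow> ('b topology \<Rightarrow> 'b set set) \<Rightarrow> 'a topology \<Rightarrow> 'a set \<Rightarrow> bool" where
  "class_complete \<Gamma> \<Gamma>' X C \<longleftrightarrow>
     zero_dim_polish X \<and> C \<in> \<Gamma> X \<and>
     (\<forall>Y B. zero_dim_polish Y \<and> B \<in> \<Gamma>' Y \<longrightarrow>
        (\<exists>f. continuous_map Y X f \<and> B = {y \<in> topspace Y. f y \<in> C}))"

end

theory Submission
  imports Defs "HOL-Library.Omega_Words_Fun"
begin

text \<open>Write \<open>B*\<close> for the set of finite concatenations of words of \<open>B\<close>.

  Membership. Call a set of words commuting if any two of its words commute under concatenation.
  The \<open>\<omega>\<close>-power of a commuting set has at most one point, so commuting sets belong to \<open>G2\<close>, and being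
  commuting is a closed condition. Suppose that \<open>A\<close> contains a finite noncommuting set \<open>F\<close>. If \<open>A\<close> and
  \<open>{u, v}\<close> have the same \<open>\<omega>\<close>-power, then \<open>u\<close> and \<open>v\<close> do not commute, and \<open>{u, v}\<close> is a code with
  bounded delay: the longest common prefix \<open>z\<close> of \<open>uv\<close> and \<open>vu\<close> is a prefix of every infinite
  product of \<open>u\<close> and \<open>v\<close>, and the letter that follows tells the first factor
  (\<open>noncommuting_imp_separated\<close>). It follows that \<open>A \<subseteq> {u, v}*\<close> (\<open>multiplier_in_generated\<close>) and, by a
  compactness argument, that a finite subset of \<open>A\<close> already has the same \<open>\<omega>\<close>-power
  (\<open>finite_subset_same_omega_power\<close>). Only finitely many pairs \<open>(u, v)\<close> satisfy \<open>F \<subseteq> {u, v}*\<close>. Let the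
  rank of \<open>F\<close> be twice the number of these pairs, plus one if \<open>F\<close> is not in \<open>G2\<close>. The rank
  can only decrease when \<open>F\<close> grows: within \<open>A\<close> it stabilises, and its final value is even exactly
  if \<open>A\<close> is in \<open>G2\<close> (\<open>G2_iff_even_minimal_rank\<close>). So the open sets of all \<open>A\<close> that
  contain a finite noncommuting set of rank at most \<open>k\<close> witness that the complement of \<open>G2\<close> is
  in \<open>D_omega\<close>.

  Hardness. Let \<open>V k\<close> be increasing open sets of a zero-dimensional Polish space, each of them an increasing union of
  clopen sets \<open>C k m\<close>. For a point \<open>y\<close>, the least \<open>k \<le> m\<close> with \<open>y \<in> C k m\<close>, once there is one, does not increase with
  \<open>m\<close> and converges to the least \<open>k\<close> with \<open>y \<in> V k\<close>. The set \<open>dictionary\<close> turns such a sequence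
  into a set of words, where step \<open>m\<close> adds only words that are longer than \<open>m\<close>; this makes the
  reduction continuous. The \<open>\<omega>\<close>-powers of \<open>{0^(2^i), 1}\<close> increase as \<open>i\<close> decreases. At an even value \<open>2i\<close>
  the added words fill up the \<open>\<omega>\<close>-power of \<open>{0^(2^i), 1}\<close>; at an odd value \<open>2i + 1\<close> they leave the
  \<open>\<omega>\<close>-power of \<open>{0^(2^(i + 1)), 1}\<close> without being able to produce \<open>0^(2^i) 1 1 1 \<dots>\<close>
  (\<open>dictionary_in_G2_iff\<close>).

  Strictness. Close to a dictionary with limit \<open>l\<close> there is one with limit \<open>l - 1\<close>, whose membership
  in \<open>G2\<close> is opposite. If \<open>G2\<close> were in \<open>D_omega\<close> by way of \<open>V k\<close>, every such change would
  force the least index \<open>k\<close> to drop, so this index exceeds \<open>l\<close>. But the set \<open>{1}\<close>, which is in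
  \<open>G2\<close>, is approached by dictionaries of every limit, and its own index cannot exceed all \<open>l\<close>.\<close>

section \<open>Omega-powers as a greatest fixed point\<close>

lemma map_upt_eq_iff_conc: "map x [0..<length w] = w \<longleftrightarrow> (\<exists>y. x = w \<frown> y)"
proof
  assume "map x [0..<length w] = w"
  then have "x = w \<frown> suffix (length w) x"
    by (metis prefix_suffix subsequence_def)
  then show "\<exists>y. x = w \<frown> y" by blast
next
  assume "\<exists>y. x = w \<frown> y"
  then show "map x [0..<length w] = w"
    by (metis prefix_conc_length subsequence_def)
qed

lemma is_inf_concat_iff:
  "is_inf_concat a x \<longleftrightarrow>
     (\<forall>k. \<exists>y. x = concat (map a [0..<k]) \<frown> y) \<and> (\<forall>m. \<exists>k. m \<le> length (concat (map a [0..<k])))"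
  by (simp add: is_inf_concat_def map_upt_eq_iff_conc)

lemma omega_powerI: "is_inf_concat a x \<Longrightarrow> (\<And>i. a i \<in> A) \<Longrightarrow> x \<in> omega_power A"
  unfolding omega_power_def by blast

lemma conc_in_omega_power:
  assumes "a \<in> A" "y \<in> omega_power A"
  shows "a \<frown> y \<in> omega_power A"
proof -
  obtain b where b: "\<And>i. b i \<in> A" "is_inf_concat b y"
    using assms(2) by (auto simp: omega_power_def)
  define c where "c = case_nat a b"
  have c: "concat (map c [0..<Suc k]) = a @ concat (map b [0..<k])" for k
    unfolding map_upt_Suc by (simp add: c_def)
  have "\<exists>z. a \<frown> y = concat (map c [0..<k]) \<frown> z" for k
  proof (cases k)
    case (Suc j)
    obtain z where "y = concat (map b [0..<j]) \<frown> z" using b(2) is_inf_concat_iff by blast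
    then show ?thesis unfolding Suc c by auto
  qed simp
  moreover have "\<exists>k. m \<le> length (concat (map c [0..<k]))" for m
  proof -
    obtain k where "m \<le> length (concat (map b [0..<k]))" using b(2) is_inf_concat_iff by blast
    then have "m \<le> length (concat (map c [0..<Suc k]))" unfolding c by simp
    then show ?thesis by blast
  qed
  ultimately have "is_inf_concat c (a \<frown> y)" by (simp add: is_inf_concat_iff)
  moreover have "c i \<in> A" for i using b(1) assms(1) by (simp add: c_def split: nat.split)
  ultimately show ?thesis unfolding omega_power_def by blast
qed

lemma concat_conc_in_omega_power:
  "w \<in> concat ` lists A \<Longrightarrow> y \<in> omega_power A \<Longrightarrow> w \<frown> y \<in> omega_power A"
proof -
  assume y: "y \<in> omega_power A" and "w \<in> concat ` lists A"
  then obtain ws where ws: "ws \<in> lists A" "w = concat ws" by auto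
  have "concat ws \<frown> y \<in> omega_power A"
    using ws(1) by induction (simp_all add: y conc_in_omega_power flip: conc_conc)
  then show ?thesis using ws(2) by simp
qed

lemma is_inf_concat_tail:
  assumes "is_inf_concat a x"
  shows "\<exists>y. x = concat (map a [0..<k]) \<frown> y \<and> is_inf_concat (\<lambda>i. a (k + i)) y"
proof -
  have split: "concat (map a [0..<k + j]) = concat (map a [0..<k]) @ concat (map (\<lambda>i. a (k + i)) [0..<j])" for j
    by (induction j) auto
  obtain y where y: "x = concat (map a [0..<k]) \<frown> y"
    using assms is_inf_concat_iff by blast
  have "\<exists>z. y = concat (map (\<lambda>i. a (k + i)) [0..<j]) \<frown> z" for j
  proof -
    obtain z where "x = concat (map a [0..<k + j]) \<frown> z"
      using assms is_inf_concat_iff by blast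
    then show ?thesis using y unfolding split by (metis conc_conc same_concat_eq)
  qed
  moreover have "\<exists>j. m \<le> length (concat (map (\<lambda>i. a (k + i)) [0..<j]))" for m
  proof -
    obtain l where l: "length (concat (map a [0..<k])) + m \<le> length (concat (map a [0..<l]))"
      using assms is_inf_concat_iff by blast
    have "length (concat (map a [0..<l])) \<le> length (concat (map a [0..<k + l]))"
    proof -
      have "[0..<k + l] = [0..<l] @ [l..<l + k]"
        using upt_add_eq_append[of 0 l k] by (simp add: add.commute)
      then show ?thesis by simp
    qed
    with l have "m \<le> length (concat (map (\<lambda>i. a (k + i)) [0..<l]))" by (simp add: split)
    then show ?thesis by blast
  qed
  ultimately show ?thesis using y by (auto simp: is_inf_concat_iff)
qed

text \<open>Together with \<open>omega_power_coinduct\<close> this makes \<open>omega_power A\<close> the greatest set \<open>X\<close> each of whose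
  points is a nonempty word of \<open>A\<close> followed by a point of \<open>X\<close>. Empty factors can be skipped because
  infinitely many factors are nonempty.\<close>

lemma omega_power_cases:
  assumes "x \<in> omega_power A"
  obtains a y where "a \<in> A" "a \<noteq> []" "y \<in> omega_power A" "x = a \<frown> y"
proof -
  obtain a where a: "\<And>i. a i \<in> A" "is_inf_concat a x"
    using assms by (auto simp: omega_power_def)
  have "\<exists>k. a k \<noteq> []"
  proof (rule ccontr)
    assume "\<nexists>k. a k \<noteq> []"
    then have nil: "concat (map a [0..<k]) = []" for k by simp
    obtain k where "1 \<le> length (concat (map a [0..<k]))"
      using a(2) is_inf_concat_iff by blast
    then show False by (simp only: nil) simp
  qed
  then obtain k where k: "a k \<noteq> []" "\<And>i. i < k \<Longrightarrow> a i = []"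
    using exists_least_iff[of "\<lambda>k. a k \<noteq> []"] by auto
  have "concat (map a [0..<k]) = []" using k(2) by simp
  then have "concat (map a [0..<Suc k]) = a k" by simp
  then obtain y where "x = a k \<frown> y" "is_inf_concat (\<lambda>i. a (Suc k + i)) y"
    using is_inf_concat_tail[OF a(2), of "Suc k"] by auto
  moreover from this(2) have "y \<in> omega_power A"
    using a(1) by (rule omega_powerI)
  ultimately show ?thesis using that a(1) k(1) by blast
qed

text \<open>Splitting off nonempty words again and again, by dependent choice, yields a factorisation
  whose partial products have unbounded length.\<close>

lemma omega_power_coinduct:
  assumes "x \<in> X"
    and step: "\<And>x. x \<in> X \<Longrightarrow> \<exists>a\<in>A. a \<noteq> [] \<and> (\<exists>y\<in>X. x = a \<frown> y)"
  shows "x \<in> omega_power A"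
proof -
  define P where "P p \<longleftrightarrow> snd p \<in> X \<and> fst p \<in> A \<and> fst p \<noteq> []" for p :: "'a list \<times> (nat \<Rightarrow> 'a)"
  obtain a0 y0 where start: "a0 \<in> A" "a0 \<noteq> []" "y0 \<in> X" "x = a0 \<frown> y0" using step assms(1) by metis
  have "\<exists>f. \<forall>n::nat. (P (f n) \<and> (n = 0 \<longrightarrow> f n = (a0, y0))) \<and> snd (f n) = fst (f (Suc n)) \<frown> snd (f (Suc n))"
  proof (rule dependent_nat_choice)
    fix p and n :: nat assume "P p \<and> (n = 0 \<longrightarrow> p = (a0, y0))"
    then have "snd p \<in> X" by (simp add: P_def)
    then obtain b z where "b \<in> A" "b \<noteq> []" "z \<in> X" "snd p = b \<frown> z" using step by metis
    then show "\<exists>q. (P q \<and> (Suc n = 0 \<longrightarrow> q = (a0, y0))) \<and> snd p = fst q \<frown> snd q"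
      by (intro exI[of _ "(b, z)"]) (auto simp: P_def)
  qed (use start in \<open>auto simp: P_def\<close>)
  then obtain f where f: "\<And>n. P (f n)" "f 0 = (a0, y0)"
      "\<And>n. snd (f n) = fst (f (Suc n)) \<frown> snd (f (Suc n))" by auto
  define a where "a n = fst (f n)" for n
  have "x = concat (map a [0..<Suc k]) \<frown> snd (f k)" for k
  proof (induction k)
    case 0
    then show ?case using f(2) start(4) by (simp add: a_def del: conc_conc)
  next
    case (Suc k)
    then show ?case using f(3)[of k] by (simp add: a_def)
  qed
  then have "\<exists>y. x = concat (map a [0..<k]) \<frown> y" for k
    by (cases k) (auto simp del: upt_Suc)
  moreover have "k \<le> length (concat (map a [0..<k]))" for k
  proof (induction k)
    case (Suc k)
    have "a k \<noteq> []" using f(1)[of k] by (simp add: a_def P_def)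
    with Suc show ?case by (cases "a k") auto
  qed simp
  ultimately have "is_inf_concat a x" by (auto simp: is_inf_concat_iff)
  moreover have "a n \<in> A" for n using f(1)[of n] by (simp add: a_def P_def)
  ultimately show ?thesis unfolding omega_power_def by blast
qed

text \<open>By coinduction over the points that start with a finite product of words of \<open>B\<close>.\<close>

lemma omega_power_mono_concat:
  assumes "A \<subseteq> concat ` lists B"
  shows "omega_power A \<subseteq> omega_power B"
proof
  fix x assume x: "x \<in> omega_power A"
  define X where "X = {concat ws \<frown> y | ws y. ws \<in> lists B \<and> y \<in> omega_power A}"
  have "x \<in> X" using x unfolding X_def by (intro CollectI exI[of _ "[]"] exI[of _ x]) simp
  then show "x \<in> omega_power B"
  proof (rule omega_power_coinduct)
    have *: "\<exists>b\<in>B. b \<noteq> [] \<and> (\<exists>y\<in>X. concat ws \<frown> z = b \<frown> y)"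
      if "ws \<in> lists B" "z \<in> omega_power A" "concat ws \<noteq> []" for ws z
      using that
    proof (induction ws)
      case (Cons w ws)
      show ?case
      proof (cases "w = []")
        case False
        have "concat ws \<frown> z \<in> X" using Cons.hyps Cons.prems unfolding X_def by fastforce
        then show ?thesis using False Cons.hyps by (intro bexI[of _ w] conjI bexI[of _ "concat ws \<frown> z"]) auto
      qed (use Cons in auto)
    qed simp
    fix x assume "x \<in> X"
    then obtain ws y where x: "ws \<in> lists B" "y \<in> omega_power A" "x = concat ws \<frown> y"
      by (auto simp: X_def)
    obtain a z where a: "a \<in> A" "a \<noteq> []" "z \<in> omega_power A" "y = a \<frown> z"
      using x(2) omega_power_cases by metis
    obtain vs where vs: "vs \<in> lists B" "a = concat vs" using a(1) assms by auto
    have "x = concat (ws @ vs) \<frown> z" using x a vs by simp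
    with * [of "ws @ vs" z] x vs a show "\<exists>b\<in>B. b \<noteq> [] \<and> (\<exists>y\<in>X. x = b \<frown> y)" by auto
  qed
qed

lemma subset_concat_lists: "B \<subseteq> concat ` lists B"
proof
  fix b assume "b \<in> B"
  then have "[b] \<in> lists B" "b = concat [b]" by auto
  then show "b \<in> concat ` lists B" by blast
qed

lemma omega_power_mono: "A \<subseteq> B \<Longrightarrow> omega_power A \<subseteq> omega_power B"
  using omega_power_mono_concat subset_concat_lists by blast

lemma omega_power_long_prefix:
  assumes "x \<in> omega_power A"
  obtains w y where "w \<in> concat ` lists A" "m \<le> length w" "y \<in> omega_power A" "x = w \<frown> y"
proof -
  obtain a where a: "\<And>i. a i \<in> A" "is_inf_concat a x"
    using assms by (auto simp: omega_power_def)
  obtain k where k: "m \<le> length (concat (map a [0..<k]))" using a(2) is_inf_concat_iff by blast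
  obtain y where y: "x = concat (map a [0..<k]) \<frown> y" "is_inf_concat (\<lambda>i. a (k + i)) y"
    using is_inf_concat_tail[OF a(2)] by blast
  have "y \<in> omega_power A" using y(2) a(1) by (rule omega_powerI)
  moreover have "map a [0..<k] \<in> lists A" using a(1) by auto
  ultimately show ?thesis using that k y(1) by blast
qed

lemma ex_is_inf_concat:
  assumes "\<And>i. s i \<noteq> []"
  shows "\<exists>x. is_inf_concat s x"
proof -
  define f where "f k = concat (map s [0..<k])" for k
  have len: "k \<le> length (f k)" for k
  proof (induction k)
    case (Suc k)
    then show ?case using assms[of k] by (cases "s k") (auto simp: f_def)
  qed (simp add: f_def)
  have ext: "f (k + l) ! i = f k ! i" if "i < length (f k)" for i k l
    using that
  proof (induction l)
    case (Suc l)
    have "length (f k) \<le> length (f (k + l))" by (induction l) (simp_all add: f_def)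
    then show ?case using Suc by (simp add: f_def nth_append)
  qed simp
  \<comment> \<open>The product of \<open>Suc i\<close> nonempty words has a letter at position \<open>i\<close>.\<close>
  define x where "x i = f (Suc i) ! i" for i
  have "x i = f k ! i" if "i < length (f k)" for i k
    using ext[of i k "Suc i"] ext[of i "Suc i" k] that len[of "Suc i"] by (simp add: x_def add.commute)
  then have "map x [0..<length (f k)] = f k" for k
    by (intro nth_equalityI) auto
  then have "is_inf_concat s x"
    using len unfolding is_inf_concat_def f_def by blast
  then show ?thesis by blast
qed

lemma ex_in_omega_power:
  assumes "a \<in> A" "a \<noteq> []" shows "\<exists>x. x \<in> omega_power A"
proof -
  have "a\<^sup>\<omega> \<in> omega_power A"
    by (rule omega_power_coinduct[of _ "{a\<^sup>\<omega>}"]) (use assms iter_unroll[of a] in auto)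
  then show ?thesis by blast
qed

section \<open>Codes with bounded delay\<close>

text \<open>The first factor of a point can be read off at one fixed position, by means of \<open>c\<close>. The common
  prefix \<open>z\<close> of all points is part of the notion because it locates this position also behind
  a finite word \<open>a\<close>, where it becomes \<open>length a + length z\<close>.\<close>

definition separated :: "'a list set \<Rightarrow> bool" where
  "separated B \<longleftrightarrow> (\<exists>z c. inj_on c B \<and> (\<forall>x \<in> omega_power B.
     (\<exists>y. x = z \<frown> y) \<and> (\<forall>b\<in>B. (b \<frown> x) (length z) = c b)))"

lemma separated_imp_disjoint:
  assumes "separated B" "b \<in> B" "b' \<in> B" "x \<in> omega_power B" "x' \<in> omega_power B" "b \<frown> x = b' \<frown> x'"
  shows "b = b'" "x = x'"
proof -
  obtain z :: "'a list" and c where inj: "inj_on c B"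
    and c: "\<And>x b. x \<in> omega_power B \<Longrightarrow> b \<in> B \<Longrightarrow> (b \<frown> x) (length z) = c b"
    using assms(1) unfolding separated_def by blast
  have "c b = c b'" using c[OF assms(4,2)] c[OF assms(5,3)] assms(6) by simp
  then show "b = b'" using inj assms(2,3) by (simp add: inj_on_eq_iff)
  then show "x = x'" using assms(6) by simp
qed

text \<open>Let \<open>z\<close> be the longest common prefix of \<open>uv\<close> and \<open>vu\<close>, which continue with the letters
  \<open>c \<noteq> d\<close>. Both \<open>zc\<close> and \<open>uz\<close> are prefixes of \<open>uvu\<close>, so \<open>zc\<close> is a prefix of \<open>uz\<close>;
  likewise \<open>zd\<close> is a prefix of \<open>vz\<close>. In particular \<open>z\<close> is a prefix of \<open>wz\<close> for every finite product
  \<open>w\<close> of \<open>u\<close> and \<open>v\<close>, hence of every infinite product.\<close>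

lemma noncommuting_imp_separated:
  assumes "u @ v \<noteq> v @ u"
  shows "separated {u, v}"
proof -
  obtain z c d p q where z: "c \<noteq> d" "u @ v = z @ c # p" "v @ u = z @ d # q"
    using same_length_different[OF assms] by auto
  have ne: "u \<noteq> []" "v \<noteq> []" using assms by auto
  define le where "le w w' \<longleftrightarrow> (\<exists>t. w' = w @ t)" for w w' :: "'a list"
  have le_same: "le w w'" if "le w t" "le w' t" "length w \<le> length w'" for w w' t
    using that unfolding le_def by (auto simp: append_eq_append_conv2)
  have le_trans: "le w t" if "le w w'" "le w' t" for w w' t
    using that unfolding le_def by auto
  have le_app: "le (s @ w) (s @ w')" if "le w w'" for s w w'
    using that unfolding le_def by auto
  have len: "length z < length (u @ v)" by (simp add: z)
  have uz: "le (z @ [c]) (u @ z)"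
  proof (rule le_same[of _ "u @ v @ u"])
    show "le (z @ [c]) (u @ v @ u)" unfolding le_def by (rule exI[of _ "p @ u"]) (simp add: z(2))
    show "le (u @ z) (u @ v @ u)" using z(3) unfolding le_def by simp
    show "length (z @ [c]) \<le> length (u @ z)" using ne by (cases u) auto
  qed
  have vz: "le (z @ [d]) (v @ z)"
  proof (rule le_same[of _ "v @ u @ v"])
    show "le (z @ [d]) (v @ u @ v)" unfolding le_def by (rule exI[of _ "q @ v"]) (simp add: z(3))
    show "le (v @ z) (v @ u @ v)" using z(2) unfolding le_def by simp
    show "length (z @ [d]) \<le> length (v @ z)" using ne by (cases v) auto
  qed
  have le_z: "le z (concat ws @ z)" if "ws \<in> lists {u, v}" for ws
    using that
  proof induction
    case (Cons s ws)
    have "le z (s @ z)" using Cons.hyps(1) uz vz le_trans unfolding le_def by auto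
    moreover have "le (s @ z) (s @ concat ws @ z)" using Cons.IH le_app by blast
    ultimately show ?case using le_trans by simp
  qed (simp add: le_def)
  have start: "\<exists>y. x = z \<frown> y" if x: "x \<in> omega_power {u, v}" for x
  proof -
    obtain w y where w: "w \<in> concat ` lists {u, v}" "length z \<le> length w" "x = w \<frown> y"
      using x by (rule omega_power_long_prefix[where m = "length z"])
    have "le z (w @ z)" using w(1) le_z by auto
    then have "le z w" using w(2) le_same[of z "w @ z" w] by (auto simp: le_def)
    then show ?thesis using w(3) unfolding le_def by (metis conc_conc)
  qed
  have letter: "(s \<frown> x) (length z) = e"
    if e: "le (z @ [e]) (s @ z)" and x: "x \<in> omega_power {u, v}" for s e x
  proof -
    obtain y t where "x = z \<frown> y" "s @ z = (z @ [e]) @ t"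
      using start[OF x] e le_def by auto
    then have "s \<frown> x = (z @ e # t) \<frown> y" by simp
    then show ?thesis by simp
  qed
  show ?thesis unfolding separated_def
    by (rule exI[of _ z], rule exI[of _ "\<lambda>s. if s = u then c else d"])
      (use start letter[OF uz] letter[OF vz] z(1) in \<open>auto simp: inj_on_def\<close>)
qed

lemma decoding_unique:
  assumes "separated B" "ws \<in> lists B" "y \<in> omega_power B" "is_inf_concat s (concat ws \<frown> y)" "\<And>i. s i \<in> B"
  shows "concat ws = concat (map s [0..<length ws])"
  using assms(2,4,5)
proof (induction arbitrary: s)
  case (Cons w ws)
  obtain x where x: "concat (w # ws) \<frown> y = s 0 \<frown> x" "is_inf_concat (\<lambda>i. s (Suc i)) x"
    using is_inf_concat_tail[OF Cons.prems(1), of 1] by auto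
  have "x \<in> omega_power B" using x(2) Cons.prems(2) by (rule omega_powerI)
  moreover have "concat ws \<frown> y \<in> omega_power B"
    using concat_conc_in_omega_power Cons.hyps assms(3) by blast
  moreover have "w \<frown> concat ws \<frown> y = s 0 \<frown> x" using x(1) by simp
  ultimately have "w = s 0" "concat ws \<frown> y = x"
    using separated_imp_disjoint[OF assms(1)] Cons.hyps(1) Cons.prems(2) by blast+
  then have "concat ws = concat (map (\<lambda>i. s (Suc i)) [0..<length ws])"
    using Cons.IH x(2) Cons.prems(2) by blast
  then show ?case using \<open>w = s 0\<close> map_upt_Suc[of s "length ws"] by (simp del: upt_Suc)
qed simp

text \<open>The letter of \<open>ax\<close> at the position \<open>length z\<close> lies inside \<open>az\<close> and so does not depend on \<open>x\<close>.
  Therefore all these points have the same first factor \<open>s\<close>. This \<open>s\<close> is a prefix of \<open>a\<close>: if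
  it were longer, then \<open>sz\<close> would also determine the letter of \<open>abx\<close> that reveals the factor \<open>b\<close>
  behind \<open>a\<close>. After cancelling \<open>s\<close>, a shorter word with the same property remains.\<close>

lemma multiplier_in_generated:
  assumes sep: "separated B" and b: "b1 \<in> B" "b2 \<in> B" "b1 \<noteq> b2"
    and "\<And>x. x \<in> omega_power B \<Longrightarrow> a \<frown> x \<in> omega_power B"
  shows "a \<in> concat ` lists B"
  using assms(5)
proof (induction "length a" arbitrary: a rule: less_induct)
  case less
  obtain z c where inj: "inj_on c B" and z: "\<And>x. x \<in> omega_power B \<Longrightarrow> \<exists>y. x = z \<frown> y"
    and c: "\<And>x b. x \<in> omega_power B \<Longrightarrow> b \<in> B \<Longrightarrow> (b \<frown> x) (length z) = c b"
    using sep unfolding separated_def by blast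
  show ?case
  proof (cases "a = []")
    case True
    then show ?thesis by (intro image_eqI[of _ _ "[]"]) auto
  next
    case False
    have "b1 \<noteq> [] \<or> b2 \<noteq> []" using b(3) by auto
    then obtain k where k: "k \<in> omega_power B" using b(1,2) ex_in_omega_power[of _ B] by blast
    have letter: "(a \<frown> x) (length z) = (a @ z) ! length z" if x: "x \<in> omega_power B" for x
    proof -
      obtain y where "x = z \<frown> y" using z[OF x] by blast
      then show ?thesis using False by simp
    qed
    have factor: "\<exists>s\<in>B. s \<noteq> [] \<and> (\<exists>y\<in>omega_power B. a \<frown> x = s \<frown> y) \<and> c s = (a @ z) ! length z"
      if x: "x \<in> omega_power B" for x
    proof -
      obtain s y where "s \<in> B" "s \<noteq> []" "y \<in> omega_power B" "a \<frown> x = s \<frown> y"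
        using omega_power_cases[OF less.prems[OF x]] by blast
      then show ?thesis using letter[OF x] c[of y s] by auto
    qed
    obtain s where s: "s \<in> B" "s \<noteq> []" "c s = (a @ z) ! length z" using factor[OF k] by blast
    have via_s: "\<exists>y\<in>omega_power B. a \<frown> x = s \<frown> y" if "x \<in> omega_power B" for x
      using factor[OF that] s inj by (metis inj_onD)
    have "length s \<le> length a"
    proof (rule ccontr)
      assume short: "\<not> length s \<le> length a"
      have "c b = (s @ z) ! (length a + length z)" if b: "b \<in> B" for b
      proof -
        have "b \<frown> k \<in> omega_power B" using b k conc_in_omega_power by blast
        then obtain y where y: "y \<in> omega_power B" "a \<frown> b \<frown> k = s \<frown> y" using via_s by blast
        obtain t where "y = z \<frown> t" using z[OF y(1)] by blast
        then have "(a \<frown> b \<frown> k) (length a + length z) = ((s @ z) \<frown> t) (length a + length z)"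
          using y(2) by simp
        also have "\<dots> = (s @ z) ! (length a + length z)" using short by (subst conc_fst) auto
        finally have "(b \<frown> k) (length z) = (s @ z) ! (length a + length z)"
          by (simp add: conc_def[of a] del: conc_conc)
        then show ?thesis using c k b by simp
      qed
      then show False using b inj by (metis inj_onD)
    qed
    moreover obtain y where "a \<frown> k = s \<frown> y" using via_s[OF k] by blast
    ultimately have "take (length s) a = s"
      using prefix_conc_fst[of "length s" a k] prefix_conc_length[of s y] by simp
    then obtain a' where a': "a = s @ a'" by (metis append_take_drop_id)
    have "a' \<frown> x \<in> omega_power B" if "x \<in> omega_power B" for x
      using via_s[OF that] unfolding a' by (metis conc_conc same_concat_eq)
    moreover have "length a' < length a" using s(2) a' by simp
    ultimately obtain ws where "ws \<in> lists B" "a' = concat ws" using less.hyps by blast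
    then show ?thesis using a' s(1) by (intro image_eqI[of _ _ "s # ws"]) auto
  qed
qed

text \<open>Compactness, in the form of Koenig's lemma. Say that a product \<open>w\<close> of words of \<open>B\<close> is covered
  if finitely many words of \<open>A\<close> suffice to split off a first factor from all points that start with \<open>w\<close>. If
  the empty word were not covered, there would be an infinite branch of uncovered products. Its
  limit starts with a word of \<open>A\<close>, which by unique decoding is one of the products on the
  branch and covers itself.\<close>

lemma finite_subset_same_omega_power:
  assumes sep: "separated B" and "finite B" and A: "A \<subseteq> concat ` lists B" "omega_power A = omega_power B"
  obtains F where "finite F" "F \<subseteq> A" "omega_power F = omega_power B"
proof -
  define covered where "covered w \<longleftrightarrow> (\<exists>F. finite F \<and> F \<subseteq> A \<and>
     (\<forall>y\<in>omega_power B. \<exists>a\<in>F. a \<noteq> [] \<and> (\<exists>y'\<in>omega_power B. w \<frown> y = a \<frown> y')))" for w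
  have step: "\<exists>b\<in>B. b \<noteq> [] \<and> \<not> covered (w @ b)" if "\<not> covered w" for w
  proof (rule ccontr)
    assume "\<not> (\<exists>b\<in>B. b \<noteq> [] \<and> \<not> covered (w @ b))"
    then have "\<forall>b\<in>{b\<in>B. b \<noteq> []}. covered (w @ b)" by blast
    from bchoice[OF this[unfolded covered_def]]
    obtain F where "\<forall>b\<in>{b \<in> B. b \<noteq> []}. finite (F b) \<and> F b \<subseteq> A \<and>
       (\<forall>y\<in>omega_power B. \<exists>a\<in>F b. a \<noteq> [] \<and> (\<exists>y'\<in>omega_power B. (w @ b) \<frown> y = a \<frown> y'))"
      by blast
    then have F: "finite (F b) \<and> F b \<subseteq> A \<and>
       (\<forall>y\<in>omega_power B. \<exists>a\<in>F b. a \<noteq> [] \<and> (\<exists>y'\<in>omega_power B. (w @ b) \<frown> y = a \<frown> y'))"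
      if "b \<in> B" "b \<noteq> []" for b
      using that by blast
    have "\<exists>a\<in>\<Union>(F ` (B - {[]})). a \<noteq> [] \<and> (\<exists>y'\<in>omega_power B. w \<frown> y = a \<frown> y')"
      if y: "y \<in> omega_power B" for y
    proof -
      obtain b t where b: "b \<in> B" "b \<noteq> []" "t \<in> omega_power B" "y = b \<frown> t"
        using omega_power_cases[OF y] by blast
      then obtain a y' where "a \<in> F b" "a \<noteq> []" "y' \<in> omega_power B" "(w @ b) \<frown> t = a \<frown> y'"
        using F[of b] by meson
      then show ?thesis using b by auto
    qed
    moreover have "finite (\<Union>(F ` (B - {[]})))" "\<Union>(F ` (B - {[]})) \<subseteq> A" using F \<open>finite B\<close> by auto
    ultimately have "covered w" unfolding covered_def by blast
    with that show False by blast
  qed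
  have "covered []"
  proof (rule ccontr)
    assume "\<not> covered []"
    have "\<exists>f. \<forall>n::nat. (\<not> covered (f n) \<and> (n = 0 \<longrightarrow> f n = [])) \<and> (\<exists>b\<in>B. b \<noteq> [] \<and> f (Suc n) = f n @ b)"
    proof (rule dependent_nat_choice)
      fix w and n :: nat assume "\<not> covered w \<and> (n = 0 \<longrightarrow> w = [])"
      then obtain b where "b \<in> B" "b \<noteq> []" "\<not> covered (w @ b)" using step by blast
      then show "\<exists>w'. (\<not> covered w' \<and> (Suc n = 0 \<longrightarrow> w' = [])) \<and> (\<exists>b\<in>B. b \<noteq> [] \<and> w' = w @ b)" by auto
    qed (use \<open>\<not> covered []\<close> in auto)
    then obtain f where f: "\<And>n. \<not> covered (f n)" "f 0 = []" "\<And>n. \<exists>b\<in>B. b \<noteq> [] \<and> f (Suc n) = f n @ b"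
      by auto
    from f(3) obtain s where s: "\<And>n. s n \<in> B \<and> s n \<noteq> [] \<and> f (Suc n) = f n @ s n" by metis
    have f_eq: "f n = concat (map s [0..<n])" for n
      by (induction n) (simp_all add: f(2) s)
    obtain x where x: "is_inf_concat s x" using ex_is_inf_concat s by blast
    then have "x \<in> omega_power A" unfolding A(2) by (rule omega_powerI) (use s in blast)
    then obtain a y where a: "a \<in> A" "a \<noteq> []" "y \<in> omega_power B" "x = a \<frown> y"
      using omega_power_cases A(2) by metis
    obtain ws where ws: "ws \<in> lists B" "a = concat ws" using a(1) A(1) by auto
    have "a = f (length ws)"
      unfolding f_eq ws(2) using decoding_unique[OF sep ws(1) a(3), of s] x a(4) ws(2) s by blast
    then have "covered (f (length ws))"
      unfolding covered_def using a(1,2) by (intro exI[of _ "{a}"]) auto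
    then show False using f(1) by blast
  qed
  then obtain F where F: "finite F" "F \<subseteq> A"
      "\<And>y. y \<in> omega_power B \<Longrightarrow> \<exists>a\<in>F. a \<noteq> [] \<and> (\<exists>y'\<in>omega_power B. y = a \<frown> y')"
    unfolding covered_def by auto
  have "omega_power B \<subseteq> omega_power F"
    using omega_power_coinduct[of _ "omega_power B" F] F(3) by blast
  moreover have "omega_power F \<subseteq> omega_power B" using F(2) A(2) omega_power_mono by blast
  ultimately show ?thesis using that F by blast
qed

section \<open>Commuting sets of words\<close>

definition commuting :: "'a list set \<Rightarrow> bool" where
  "commuting A \<longleftrightarrow> (\<forall>a\<in>A. \<forall>b\<in>A. a @ b = b @ a)"

lemma commuting_subset: "commuting B \<Longrightarrow> A \<subseteq> B \<Longrightarrow> commuting A"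
  unfolding commuting_def by blast

text \<open>Long prefixes of the two points are finite products of words of \<open>A\<close>. These commute, so both are
  prefixes of one word.\<close>

lemma commuting_omega_power_unique:
  assumes "commuting A" "x \<in> omega_power A" "y \<in> omega_power A"
  shows "x = y"
proof
  fix i
  have comm_concat: "v @ w = w @ v" if "v \<in> concat ` lists A" "w \<in> concat ` lists A" for v w
  proof -
    have 1: "concat ws @ a = a @ concat ws" if "ws \<in> lists A" "a \<in> A" for ws a
      using that(1)
    proof induction
      case (Cons b ws)
      then show ?case using assms(1) that(2) unfolding commuting_def by (metis append.assoc concat.simps(2))
    qed simp
    have 2: "concat ws @ concat vs = concat vs @ concat ws" if "ws \<in> lists A" "vs \<in> lists A" for ws vs
      using that(2)
    proof induction
      case (Cons b vs)
      then show ?case using 1[OF that(1), of b] by (metis append.assoc concat.simps(2))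
    qed simp
    then show ?thesis using that by auto
  qed
  obtain v x' where v: "v \<in> concat ` lists A" "Suc i \<le> length v" "x = v \<frown> x'"
    using omega_power_long_prefix[OF assms(2)] by metis
  obtain w y' where w: "w \<in> concat ` lists A" "Suc i \<le> length w" "y = w \<frown> y'"
    using omega_power_long_prefix[OF assms(3)] by metis
  have "x i = (v @ w) ! i" using v by (simp add: nth_append)
  also have "\<dots> = (w @ v) ! i" using comm_concat v w by simp
  also have "\<dots> = y i" using w by (simp add: nth_append)
  finally show "x i = y i" .
qed

text \<open>Both \<open>abx\<close> and \<open>bax\<close> are points, and \<open>ab\<close> and \<open>ba\<close> have the same length.\<close>

lemma omega_power_unique_imp_commuting:
  assumes "\<And>x y. x \<in> omega_power A \<Longrightarrow> y \<in> omega_power A \<Longrightarrow> x = y"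
  shows "commuting A"
  unfolding commuting_def
proof (intro ballI)
  fix a b assume ab: "a \<in> A" "b \<in> A"
  show "a @ b = b @ a"
  proof (cases "a = []")
    case False
    then obtain x where x: "x \<in> omega_power A" using ab(1) ex_in_omega_power[of a A] by blast
    have "a \<frown> b \<frown> x \<in> omega_power A" "b \<frown> a \<frown> x \<in> omega_power A"
      using x ab conc_in_omega_power by blast+
    then have "(a @ b) \<frown> x = (b @ a) \<frown> x" using assms by simp
    then show ?thesis by (subst (asm) concat_eq) auto
  qed simp
qed

lemma commuting_iff_omega_power_unique:
  "commuting A \<longleftrightarrow> (\<forall>x\<in>omega_power A. \<forall>y\<in>omega_power A. x = y)"
  by (metis commuting_omega_power_unique omega_power_unique_imp_commuting)

lemma commuting_in_G2:
  assumes "A \<subseteq> lists {..<n}" "commuting A"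
  shows "A \<in> G2 n"
proof (cases "A \<subseteq> {[]}")
  case True
  then have "omega_power A \<subseteq> omega_power {[], []}" using omega_power_mono by auto
  moreover have "omega_power {[] :: nat list, []} = {}"
  proof (rule equals0I)
    fix x :: "nat \<Rightarrow> nat" assume "x \<in> omega_power {[], []}"
    then show False by (rule omega_power_cases) simp
  qed
  ultimately show ?thesis using assms(1) unfolding G2_def by (auto intro!: bexI[of _ "[]"])
next
  case False
  then obtain a where a: "a \<in> A" "a \<noteq> []" by auto
  have "omega_power {a, a} \<subseteq> omega_power A" using a(1) by (intro omega_power_mono) auto
  moreover obtain x where "x \<in> omega_power {a, a}" using a(2) ex_in_omega_power[of a "{a, a}"] by blast
  ultimately have "omega_power A = omega_power {a, a}"
    using commuting_omega_power_unique[OF assms(2)] by blast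
  then show ?thesis using a(1) assms(1) unfolding G2_def by blast
qed

section \<open>The rank of a finite set of words\<close>

text \<open>The pairs that can still have the same \<open>\<omega>\<close>-power as a superset of \<open>A\<close>.\<close>

definition generators :: "nat \<Rightarrow> nat list set \<Rightarrow> (nat list \<times> nat list) set" where
  "generators n A = {(u, v). u \<in> lists {..<n} \<and> v \<in> lists {..<n} \<and> u @ v \<noteq> v @ u \<and> A \<subseteq> concat ` lists {u, v}}"

lemma generators_antimono: "A \<subseteq> B \<Longrightarrow> generators n B \<subseteq> generators n A"
  unfolding generators_def by auto

lemma generatorsD: "(u, v) \<in> generators n A \<Longrightarrow> A \<subseteq> concat ` lists {u, v}"
  unfolding generators_def by simp

lemma commuting_concat_lists:
  assumes "commuting B" "A \<subseteq> concat ` lists B"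
  shows "commuting A"
  using assms omega_power_mono_concat[OF assms(2)] unfolding commuting_iff_omega_power_unique by blast

lemma generators_if_same_omega_power:
  assumes "A \<subseteq> lists {..<n}" "\<not> commuting A" "u \<in> lists {..<n}" "v \<in> lists {..<n}"
    "omega_power A = omega_power {u, v}"
  shows "(u, v) \<in> generators n A"
proof -
  have "\<not> commuting {u, v}" using assms(2,5) unfolding commuting_iff_omega_power_unique by simp
  then have uv: "u @ v \<noteq> v @ u" by (auto simp: commuting_def)
  have "a \<in> concat ` lists {u, v}" if "a \<in> A" for a
  proof (rule multiplier_in_generated[OF noncommuting_imp_separated[OF uv], of u v])
    show "a \<frown> x \<in> omega_power {u, v}" if "x \<in> omega_power {u, v}" for x
      using that \<open>a \<in> A\<close> conc_in_omega_power assms(5) by blast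
  qed (use uv in auto)
  then show ?thesis using assms(3,4) uv unfolding generators_def by blast
qed

lemma noncommuting_in_G2_iff:
  assumes "A \<subseteq> lists {..<n}" "\<not> commuting A"
  shows "A \<in> G2 n \<longleftrightarrow> (\<exists>(u, v) \<in> generators n A. omega_power A = omega_power {u, v})"
proof
  assume "A \<in> G2 n"
  then obtain u v where "u \<in> lists {..<n}" "v \<in> lists {..<n}" "omega_power A = omega_power {u, v}"
    unfolding G2_def by blast
  then show "\<exists>(u, v) \<in> generators n A. omega_power A = omega_power {u, v}"
    using generators_if_same_omega_power[OF assms] by blast
next
  assume "\<exists>(u, v) \<in> generators n A. omega_power A = omega_power {u, v}"
  then show "A \<in> G2 n" using assms(1) unfolding G2_def generators_def by auto
qed

text \<open>Since \<open>A\<close> is not commuting, products of one word do not give all of \<open>A\<close>. So each of the two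
  words is a factor of some word of \<open>A\<close>, which bounds its length.\<close>

lemma finite_generators:
  assumes "finite A" "\<not> commuting A"
  shows "finite (generators n A)"
proof -
  define L where "L = Max (length ` A)"
  have short: "length u \<le> L" if uv: "A \<subseteq> concat ` lists {u, v}" for u v
  proof (rule ccontr)
    assume long: "\<not> length u \<le> L"
    have "A \<subseteq> concat ` lists {v}"
    proof
      fix a assume "a \<in> A"
      then obtain ws where ws: "ws \<in> lists {u, v}" "a = concat ws" using uv by auto
      have "length a \<le> L" using \<open>a \<in> A\<close> assms(1) unfolding L_def by simp
      moreover have "length u \<le> length a" if "u \<in> set ws"
        using split_list[OF that] ws(2) by auto
      ultimately have "ws \<in> lists {v}" using ws(1) long by auto
      then show "a \<in> concat ` lists {v}" using ws(2) by blast
    qed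
    then have "commuting A" by (rule commuting_concat_lists[rotated]) (simp add: commuting_def)
    with assms(2) show False by contradiction
  qed
  have "generators n A \<subseteq> {w. set w \<subseteq> {..<n} \<and> length w \<le> L} \<times> {w. set w \<subseteq> {..<n} \<and> length w \<le> L}"
  proof (clarify, intro SigmaI CollectI conjI)
    fix u v assume uv: "(u, v) \<in> generators n A"
    show "set u \<subseteq> {..<n}" "set v \<subseteq> {..<n}" using uv by (auto simp: generators_def)
    show "length u \<le> L" using short generatorsD[OF uv] by blast
    have "{v, u} = {u, v}" by blast
    then show "length v \<le> L" using short[of v u] generatorsD[OF uv] by simp
  qed
  then show ?thesis
    by (rule finite_subset) (intro finite_cartesian_product finite_lists_length_le finite_lessThan)
qed

text \<open>The number of times that membership in \<open>G2\<close> can still change while \<open>F\<close> grows is at most the rank: a pair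
  of generators that is excluded accounts for two changes. The parity records the present state.\<close>

definition G2_rank :: "nat \<Rightarrow> nat list set \<Rightarrow> nat" where
  "G2_rank n F = 2 * card (generators n F) + of_bool (F \<notin> G2 n)"

lemma even_G2_rank_iff: "even (G2_rank n F) \<longleftrightarrow> F \<in> G2 n"
  by (simp add: G2_rank_def)

text \<open>As long as the set of generators stays the same, a member of \<open>G2\<close> remains one, since its
  supersets are still generated by the same pair. If the set of generators shrinks, its contribution
  falls by at least two, which outweighs the summand for membership.\<close>

lemma G2_rank_antimono:
  assumes F: "finite F" "\<not> commuting F" and F': "finite F'" "F \<subseteq> F'" "F' \<subseteq> lists {..<n}"
  shows "G2_rank n F' \<le> G2_rank n F"
    and "G2_rank n F' = G2_rank n F \<Longrightarrow> generators n F' = generators n F"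
proof -
  have sub: "generators n F' \<subseteq> generators n F" using generators_antimono[OF F'(2)] .
  have fin: "finite (generators n F)" using finite_generators F by blast
  have nc: "\<not> commuting F'" using F(2) F'(2) commuting_subset by blast
  consider "generators n F' = generators n F" | "card (generators n F') < card (generators n F)"
    using psubset_card_mono[OF fin] sub by blast
  then have "G2_rank n F' \<le> G2_rank n F \<and> (G2_rank n F' = G2_rank n F \<longrightarrow> generators n F' = generators n F)"
  proof cases
    case 1
    have "F' \<in> G2 n" if F_G2: "F \<in> G2 n"
    proof -
      have "F \<subseteq> lists {..<n}" using F' by blast
      then obtain u v where uv: "(u, v) \<in> generators n F" "omega_power F = omega_power {u, v}"
        using noncommuting_in_G2_iff[of F n] F(2) F_G2 by blast
      have "F' \<subseteq> concat ` lists {u, v}" using uv(1) 1 generatorsD by metis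
      then have "omega_power F' = omega_power {u, v}"
        using omega_power_mono[OF F'(2)] omega_power_mono_concat uv(2) by blast
      then show ?thesis using noncommuting_in_G2_iff[OF F'(3) nc] uv(1) 1 by blast
    qed
    then show ?thesis using 1 by (auto simp: G2_rank_def)
  next
    case 2
    then show ?thesis by (auto simp: G2_rank_def of_bool_def)
  qed
  then show "G2_rank n F' \<le> G2_rank n F" "G2_rank n F' = G2_rank n F \<Longrightarrow> generators n F' = generators n F"
    by auto
qed

text \<open>A finite set of minimal rank shows the final state. If it is in \<open>G2\<close>, then its generators \<open>u\<close> and \<open>v\<close>
  are never excluded, so that \<open>A \<subseteq> {u, v}*\<close>. If \<open>A\<close> is in \<open>G2\<close>, compactness provides a finite
  superset of \<open>F\<close> within \<open>A\<close> that is in \<open>G2\<close>, and it has the same rank as \<open>F\<close>.\<close>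

lemma G2_iff_even_minimal_rank:
  assumes A: "A \<subseteq> lists {..<n}" and F: "finite F" "F \<subseteq> A" "\<not> commuting F"
    and min: "\<And>F'. finite F' \<Longrightarrow> F' \<subseteq> A \<Longrightarrow> \<not> commuting F' \<Longrightarrow> G2_rank n F \<le> G2_rank n F'"
  shows "A \<in> G2 n \<longleftrightarrow> even (G2_rank n F)"
proof -
  have stable: "G2_rank n F' = G2_rank n F \<and> generators n F' = generators n F"
    if "finite F'" "F \<subseteq> F'" "F' \<subseteq> A" for F'
  proof -
    have "\<not> commuting F'" using F(3) that(2) commuting_subset by blast
    then have "G2_rank n F \<le> G2_rank n F'" using min that by blast
    then show ?thesis using G2_rank_antimono[OF F(1,3) that(1,2)] that(3) A by (meson le_antisym subset_trans)
  qed
  have nc: "\<not> commuting A" using F(2,3) commuting_subset by blast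
  have F_sub: "F \<subseteq> lists {..<n}" using A F(2) by blast
  show ?thesis
  proof
    assume "even (G2_rank n F)"
    then have "F \<in> G2 n" using even_G2_rank_iff by blast
    then obtain u v where uv: "(u, v) \<in> generators n F" "omega_power F = omega_power {u, v}"
      using noncommuting_in_G2_iff[OF F_sub F(3)] by auto
    have "a \<in> concat ` lists {u, v}" if "a \<in> A" for a
    proof -
      have "(u, v) \<in> generators n (insert a F)"
        using stable[of "insert a F"] uv(1) that F(1,2) by blast
      then show ?thesis by (simp add: generators_def)
    qed
    then have "A \<subseteq> concat ` lists {u, v}" by blast
    then have "omega_power A = omega_power {u, v}"
      using omega_power_mono[OF F(2)] omega_power_mono_concat uv(2) by blast
    then show "A \<in> G2 n" using A uv(1) unfolding G2_def generators_def by blast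
  next
    assume "A \<in> G2 n"
    then obtain u v where uv: "(u, v) \<in> generators n A" "omega_power A = omega_power {u, v}"
      using noncommuting_in_G2_iff[OF A nc] by auto
    have "separated {u, v}" "A \<subseteq> concat ` lists {u, v}"
      using uv(1) noncommuting_imp_separated unfolding generators_def by auto
    then obtain E where E: "finite E" "E \<subseteq> A" "omega_power E = omega_power {u, v}"
      using finite_subset_same_omega_power[of "{u, v}" A] uv(2) by auto
    have "omega_power (E \<union> F) = omega_power {u, v}"
      using omega_power_mono[of E "E \<union> F"] omega_power_mono[of "E \<union> F" A] E F(2) uv(2) by blast
    then have "E \<union> F \<in> G2 n"
      using uv(1) A E(2) F(2) unfolding G2_def generators_def by blast
    then show "even (G2_rank n F)"
      using even_G2_rank_iff stable[of "E \<union> F"] E F by (metis Un_least Un_upper2 finite_UnI)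
  qed
qed

section \<open>The topology of the power set\<close>

text \<open>The cylinders given by a finite set \<open>E\<close> of coordinates form a base.\<close>

lemma openin_powerset_topology_iff:
  "openin (powerset_topology I) W \<longleftrightarrow> W \<subseteq> Pow I \<and>
     (\<forall>A\<in>W. \<exists>E. finite E \<and> E \<subseteq> I \<and> (\<forall>B\<subseteq>I. B \<inter> E = A \<inter> E \<longrightarrow> B \<in> W))"
  (is "?lhs \<longleftrightarrow> ?rhs")
proof
  define chi where "chi A = (\<lambda>s\<in>I. s \<in> A)" for A :: "'a set"
  define T where "T = product_topology (\<lambda>_. discrete_topology (UNIV :: bool set)) I"
  have openin_X: "openin (powerset_topology I) W \<longleftrightarrow> (\<exists>U. openin T U \<and> W = chi -` U \<inter> Pow I)" for W
    by (simp add: powerset_topology_def openin_pullback_topology T_def chi_def[abs_def])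
  {
    assume ?lhs
    then obtain U where U: "openin T U" "W = chi -` U \<inter> Pow I" unfolding openin_X by auto
    have "\<exists>E. finite E \<and> E \<subseteq> I \<and> (\<forall>B\<subseteq>I. B \<inter> E = A \<inter> E \<longrightarrow> B \<in> W)"
      if A: "A \<in> W" for A
    proof -
      have "chi A \<in> U" using A U(2) by blast
      then obtain V where V: "finite {i \<in> I. V i \<noteq> UNIV}" "chi A \<in> Pi\<^sub>E I V" "Pi\<^sub>E I V \<subseteq> U"
        using U(1) unfolding T_def openin_product_topology_alt by auto
      have "B \<in> W" if "B \<subseteq> I" "B \<inter> {i \<in> I. V i \<noteq> UNIV} = A \<inter> {i \<in> I. V i \<noteq> UNIV}" for B
      proof -
        have "chi B i \<in> V i" if "i \<in> I" for i
        proof (cases "V i = UNIV")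
          case False
          then have "i \<in> B \<longleftrightarrow> i \<in> A"
            using \<open>B \<inter> _ = A \<inter> _\<close> that by blast
          then have "chi B i = chi A i" by (simp add: chi_def)
          then show ?thesis using V(2) that by auto
        qed simp
        then have "chi B \<in> Pi\<^sub>E I V" by (auto simp: chi_def)
        then show ?thesis using V(3) U(2) \<open>B \<subseteq> I\<close> by blast
      qed
      then show ?thesis using V(1) by (intro exI[of _ "{i \<in> I. V i \<noteq> UNIV}"]) blast
    qed
    moreover have "W \<subseteq> Pow I" using U(2) by simp
    ultimately show ?rhs by simp
  next
    assume R: ?rhs
    define V where "V A E i = (if i \<in> E then {i \<in> A} else (UNIV :: bool set))" for A E :: "'a set" and i
    define U where "U = \<Union>{Pi\<^sub>E I (V A E) | A E. finite E \<and> E \<subseteq> I \<and> (\<forall>B\<subseteq>I. B \<inter> E = A \<inter> E \<longrightarrow> B \<in> W)}"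
    have in_V: "chi B \<in> Pi\<^sub>E I (V A E) \<longleftrightarrow> B \<inter> E = A \<inter> E" if "E \<subseteq> I" for A B E
      using that by (auto simp: chi_def V_def PiE_iff)
    have "openin T U"
      unfolding U_def
    proof (rule openin_Union)
      fix S assume "S \<in> {Pi\<^sub>E I (V A E) | A E. finite E \<and> E \<subseteq> I \<and> (\<forall>B\<subseteq>I. B \<inter> E = A \<inter> E \<longrightarrow> B \<in> W)}"
      then obtain A E where S: "S = Pi\<^sub>E I (V A E)" "finite E" by blast
      have "{i \<in> I. V A E i \<noteq> UNIV} \<subseteq> E" by (auto simp: V_def)
      then have "finite {i \<in> I. V A E i \<noteq> UNIV}" using S(2) finite_subset by blast
      then show "openin T S" unfolding T_def S(1) by (simp add: openin_PiE_gen)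
    qed
    moreover have "W = chi -` U \<inter> Pow I"
    proof (intro equalityI subsetI)
      fix A assume A: "A \<in> W"
      then obtain E where E: "finite E" "E \<subseteq> I" "\<forall>B\<subseteq>I. B \<inter> E = A \<inter> E \<longrightarrow> B \<in> W" using R by blast
      have "chi A \<in> Pi\<^sub>E I (V A E)" using in_V E(2) by blast
      then have "chi A \<in> U" using E unfolding U_def by blast
      then show "A \<in> chi -` U \<inter> Pow I" using A R by blast
    next
      fix B assume "B \<in> chi -` U \<inter> Pow I"
      then show "B \<in> W" unfolding U_def using in_V by auto
    qed
    ultimately show ?lhs unfolding openin_X by blast
  }
qed

lemma openin_powerset_topologyE:
  assumes "openin (powerset_topology I) W" "A \<in> W"
  obtains E where "finite E" "E \<subseteq> I" "\<And>B. B \<subseteq> I \<Longrightarrow> B \<inter> E = A \<inter> E \<Longrightarrow> B \<in> W"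
  using assms unfolding openin_powerset_topology_iff by meson

lemma openin_contains_finite: "finite F \<Longrightarrow> F \<subseteq> I \<Longrightarrow> openin (powerset_topology I) {A. F \<subseteq> A \<and> A \<subseteq> I}"
  unfolding openin_powerset_topology_iff by (auto intro!: exI[of _ F])

lemma continuous_map_into_powerset_topology:
  assumes "\<And>y. y \<in> topspace Y \<Longrightarrow> f y \<subseteq> I"
    and pos: "\<And>s. s \<in> I \<Longrightarrow> openin Y {y \<in> topspace Y. s \<in> f y}"
    and neg: "\<And>s. s \<in> I \<Longrightarrow> openin Y {y \<in> topspace Y. s \<notin> f y}"
  shows "continuous_map Y (powerset_topology I) f"
  unfolding continuous_map_def
proof (intro conjI allI impI)
  show "f \<in> topspace Y \<rightarrow> topspace (powerset_topology I)" using assms(1) by auto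
  fix W assume W: "openin (powerset_topology I) W"
  show "openin Y {y \<in> topspace Y. f y \<in> W}"
  proof (subst openin_subopen, intro ballI)
    fix x assume "x \<in> {y \<in> topspace Y. f y \<in> W}"
    then have x: "x \<in> topspace Y" "f x \<in> W" by auto
    then obtain E where E: "finite E" "E \<subseteq> I" "\<And>B. B \<subseteq> I \<Longrightarrow> B \<inter> E = f x \<inter> E \<Longrightarrow> B \<in> W"
      using W openin_powerset_topologyE by metis
    define N where "N s = {y \<in> topspace Y. s \<in> f y \<longleftrightarrow> s \<in> f x}" for s
    have "openin Y (N s)" if "s \<in> I" for s
      using pos[OF that] neg[OF that] by (cases "s \<in> f x") (simp_all add: N_def)
    then have "openin Y (\<Inter>s\<in>E. N s)" if "E \<noteq> {}"
      using E(1,2) that by (intro openin_INT2) auto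
    then have "openin Y (topspace Y \<inter> (\<Inter>s\<in>E. N s))"
      by (cases "E = {}") (simp_all add: openin_Int)
    moreover have "x \<in> topspace Y \<inter> (\<Inter>s\<in>E. N s)" using x(1) by (simp add: N_def)
    moreover have "topspace Y \<inter> (\<Inter>s\<in>E. N s) \<subseteq> {y \<in> topspace Y. f y \<in> W}"
    proof
      fix y assume y: "y \<in> topspace Y \<inter> (\<Inter>s\<in>E. N s)"
      then have "f y \<inter> E = f x \<inter> E" unfolding N_def by blast
      then show "y \<in> {y \<in> topspace Y. f y \<in> W}" using E(3) assms(1) y by blast
    qed
    ultimately show "\<exists>T. openin Y T \<and> x \<in> T \<and> T \<subseteq> {y \<in> topspace Y. f y \<in> W}" by blast
  qed
qed

lemma powerset_topology_homeomorphic_product: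
  "powerset_topology I homeomorphic_space product_topology (\<lambda>_. discrete_topology (UNIV :: bool set)) I"
proof -
  define chi where "chi A = (\<lambda>s\<in>I. s \<in> A)" for A :: "'a set"
  define T where "T = product_topology (\<lambda>_. discrete_topology (UNIV :: bool set)) I"
  have X: "powerset_topology I = pullback_topology (Pow I) chi T"
    by (simp add: powerset_topology_def T_def chi_def[abs_def])
  have "homeomorphic_maps (powerset_topology I) T chi (\<lambda>g. {s\<in>I. g s})"
    unfolding homeomorphic_maps_def
  proof (intro conjI ballI)
    show "continuous_map (powerset_topology I) T chi"
      unfolding X using continuous_map_pullback[of T T id "Pow I" chi] by simp
    show "continuous_map T (powerset_topology I) (\<lambda>g. {s\<in>I. g s})"
      unfolding X
    proof (rule continuous_map_pullback')
      show "continuous_map T T (chi \<circ> (\<lambda>g. {s \<in> I. g s}))"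
        by (rule continuous_map_eq[OF continuous_map_id]) (auto simp: T_def chi_def PiE_iff extensional_def fun_eq_iff)
    qed auto
    show "{s \<in> I. chi A s} = A" if "A \<in> topspace (powerset_topology I)" for A
      using that by (auto simp: chi_def)
    show "chi {s \<in> I. g s} = g" if "g \<in> topspace T" for g
      using that by (auto simp: T_def chi_def PiE_iff extensional_def fun_eq_iff)
  qed
  then show ?thesis unfolding T_def homeomorphic_space_def by blast
qed

lemma zero_dim_polish_powerset_topology:
  assumes "countable I"
  shows "zero_dim_polish (powerset_topology I)"
  unfolding zero_dim_polish_def
proof (intro conjI)
  have "completely_metrizable_space (product_topology (\<lambda>_. discrete_topology (UNIV :: bool set)) I)"
    unfolding completely_metrizable_space_product_topology
    using assms by (auto simp: completely_metrizable_space_discrete_topology intro: countable_subset)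
  then show "completely_metrizable_space (powerset_topology I)"
    using homeomorphic_completely_metrizable_space powerset_topology_homeomorphic_product by blast
  have "powerset_topology I closure_of {A. finite A \<and> A \<subseteq> I} = Pow I"
  proof (intro equalityI subsetI)
    fix A assume A: "A \<in> Pow I"
    have "\<exists>B\<in>{A. finite A \<and> A \<subseteq> I}. B \<in> W" if W: "A \<in> W" "openin (powerset_topology I) W" for W
    proof -
      obtain E where E: "finite E" "E \<subseteq> I" "\<And>B. B \<subseteq> I \<Longrightarrow> B \<inter> E = A \<inter> E \<Longrightarrow> B \<in> W"
        using openin_powerset_topologyE[OF W(2,1)] by blast
      have "A \<inter> E \<subseteq> I" "(A \<inter> E) \<inter> E = A \<inter> E" using A by auto
      then have "A \<inter> E \<in> W" using E(3) by simp
      then show ?thesis using E(1,2) by blast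
    qed
    then show "A \<in> powerset_topology I closure_of {A. finite A \<and> A \<subseteq> I}"
      using A by (simp add: in_closure_of)
  qed (use closure_of_subset_topspace[of "powerset_topology I"] in auto)
  moreover have "countable {A. finite A \<and> A \<subseteq> I}" using assms countable_Collect_finite_subset by blast
  ultimately show "separable_space (powerset_topology I)"
    unfolding separable_space_def by (intro exI[of _ "{A. finite A \<and> A \<subseteq> I}"]) auto
  show "powerset_topology I dim_le 0"
    unfolding dimension_le_0_neighbourhood_base_of_clopen neighbourhood_base_of
  proof (intro allI impI)
    fix W :: "'a set set" and A
    assume W: "openin (powerset_topology I) W \<and> A \<in> W"
    then obtain E where E: "finite E" "E \<subseteq> I" "\<And>B. B \<subseteq> I \<Longrightarrow> B \<inter> E = A \<inter> E \<Longrightarrow> B \<in> W"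
      using openin_powerset_topologyE by metis
    have A: "A \<in> W" "A \<subseteq> I" using W openin_subset[of "powerset_topology I" W] by auto
    have cylinder: "openin (powerset_topology I) {B. B \<subseteq> I \<and> P (B \<inter> E)}" for P
      unfolding openin_powerset_topology_iff using E(1,2) by (auto intro!: exI[of _ E])
    define U where "U = {B. B \<subseteq> I \<and> B \<inter> E = A \<inter> E}"
    have "topspace (powerset_topology I) - U = {B. B \<subseteq> I \<and> B \<inter> E \<noteq> A \<inter> E}"
      by (auto simp: U_def)
    then have "closedin (powerset_topology I) U"
      unfolding closedin_def using cylinder by (simp add: U_def subset_eq)
    moreover have "openin (powerset_topology I) U" unfolding U_def by (rule cylinder)
    moreover have "A \<in> U" "U \<subseteq> W" using A E(3) by (auto simp: U_def)
    ultimately show "\<exists>U V. openin (powerset_topology I) U \<and>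
        (closedin (powerset_topology I) V \<and> openin (powerset_topology I) V) \<and> A \<in> U \<and> U \<subseteq> V \<and> V \<subseteq> W"
      by blast
  qed
qed

section \<open>Membership in the dual class\<close>

lemma G2_in_co_D_omega: "G2 n \<in> co_D_omega (powerset_topology (lists {..<n}))"
proof -
  define X where "X = powerset_topology (lists {..<n})"
  define V where "V k = {A. A \<subseteq> lists {..<n} \<and>
     (\<exists>F. finite F \<and> F \<subseteq> A \<and> \<not> commuting F \<and> G2_rank n F \<le> k)}" for k
  define S where "S = (\<Union>k\<in>{k. odd k}. V k - (\<Union>j<k. V j))"
  have "incseq V"
    unfolding incseq_def V_def using le_trans by blast
  moreover have "openin X (V k)" for k
  proof -
    have "V k = \<Union>{{A. F \<subseteq> A \<and> A \<subseteq> lists {..<n}} | F.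
        finite F \<and> F \<subseteq> lists {..<n} \<and> \<not> commuting F \<and> G2_rank n F \<le> k}"
      unfolding V_def by blast
    then show ?thesis unfolding X_def using openin_contains_finite by (auto intro!: openin_Union)
  qed
  ultimately have "S \<in> D_omega X" unfolding D_omega_def S_def by blast
  moreover have "A \<in> G2 n \<longleftrightarrow> A \<notin> S" if A: "A \<subseteq> lists {..<n}" for A
  proof (cases "commuting A")
    case True
    then have "A \<notin> V k" for k unfolding V_def using commuting_subset by blast
    then show ?thesis using commuting_in_G2[OF A True] by (auto simp: S_def)
  next
    case False
    then obtain a b where "a \<in> A" "b \<in> A" "a @ b \<noteq> b @ a" by (auto simp: commuting_def)
    then have "\<exists>F. finite F \<and> F \<subseteq> A \<and> \<not> commuting F"
      by (intro exI[of _ "{a, b}"]) (auto simp: commuting_def)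
    then obtain F where F: "finite F \<and> F \<subseteq> A \<and> \<not> commuting F"
      and min: "\<And>F'. finite F' \<and> F' \<subseteq> A \<and> \<not> commuting F' \<Longrightarrow> G2_rank n F \<le> G2_rank n F'"
      using ex_has_least_nat[of "\<lambda>F. finite F \<and> F \<subseteq> A \<and> \<not> commuting F" _ "G2_rank n"] by metis
    have in_V: "A \<in> V k \<longleftrightarrow> G2_rank n F \<le> k" for k
    proof
      assume "A \<in> V k"
      then obtain F' where "finite F' \<and> F' \<subseteq> A \<and> \<not> commuting F'" "G2_rank n F' \<le> k"
        unfolding V_def by blast
      then show "G2_rank n F \<le> k" using min le_trans by blast
    qed (use F A in \<open>auto simp: V_def\<close>)
    have "A \<in> S \<longleftrightarrow> (\<exists>k. odd k \<and> G2_rank n F \<le> k \<and> (\<forall>j<k. \<not> G2_rank n F \<le> j))"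
      by (auto simp: S_def in_V)
    also have "\<dots> \<longleftrightarrow> odd (G2_rank n F)"
      by (metis le_eq_less_or_eq le_refl linorder_not_less)
    finally show ?thesis using G2_iff_even_minimal_rank[OF A, of F] F min by blast
  qed
  moreover have "G2 n \<subseteq> topspace X" by (auto simp: G2_def X_def)
  ultimately have "G2 n = topspace X - S" "S \<in> D_omega X" by (auto simp: X_def)
  then show ?thesis unfolding co_D_omega_def X_def by blast
qed

section \<open>Dictionaries that encode descending sequences\<close>

definition gen_words :: "nat \<Rightarrow> nat list set" where
  "gen_words i = {replicate (2 ^ i) 0, [1]}"

text \<open>The words added at step \<open>m\<close> while the value is \<open>k\<close>. For even \<open>k\<close> they make the \<open>\<omega>\<close>-power as large as that of
  \<open>gen_words (k div 2)\<close>. For odd \<open>k\<close>, the word \<open>1^m 0^(2^(k div 2))\<close> breaks the equality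
  with the \<open>\<omega>\<close>-power of a \<open>gen_words j\<close> with \<open>j > k div 2\<close>, but its block of zeros cannot be
  used at the beginning of a point. The word \<open>0^(2^(m + 1))\<close> excludes the generators \<open>1\<close> and
  \<open>1^m 0^(2^(k div 2))\<close>.\<close>

definition stage :: "nat \<Rightarrow> nat \<Rightarrow> nat list set" where
  "stage m k = (if even k then {concat ws | ws. ws \<in> lists (gen_words (k div 2)) \<and> length ws = Suc m}
     else {replicate m 1 @ replicate (2 ^ (k div 2)) 0, replicate (2 ^ Suc m) 0})"

text \<open>The word \<open>1\<close> is always present. The set \<open>T\<close> contains the steps at which the sequence \<open>r\<close> is
  defined, which is meant to be empty or a final segment of the naturals.\<close>

definition dictionary :: "nat set \<Rightarrow> (nat \<Rightarrow> nat) \<Rightarrow> nat list set" where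
  "dictionary T r = insert [1] (\<Union>m\<in>T. stage m (r m))"

text \<open>The bound \<open>r m \<le> m\<close> guarantees that the word \<open>0^(2^(m + 1))\<close> of \<open>stage m (r m)\<close> is a
  product of the words of \<open>gen_words (r m div 2)\<close>.\<close>

definition descends :: "nat set \<Rightarrow> (nat \<Rightarrow> nat) \<Rightarrow> nat \<Rightarrow> bool" where
  "descends T r l \<longleftrightarrow> (\<forall>m\<in>T. r m \<le> m \<and> (\<forall>m'\<ge>m. m' \<in> T \<and> r m' \<le> r m)) \<and> (\<exists>N\<in>T. \<forall>m\<ge>N. r m = l)"

lemma descends_limit_le:
  assumes "descends T r l" "m \<in> T" shows "l \<le> r m"
proof -
  obtain N where "\<forall>m\<ge>N. r m = l" using assms(1) unfolding descends_def by blast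
  then have "r (max m N) = l" by simp
  then show ?thesis using assms unfolding descends_def by (metis max.cobounded1)
qed

text \<open>Membership of a word \<open>w\<close> in a dictionary thus depends only on the steps before \<open>length w\<close>,
  which makes dictionaries depend continuously on the sequence.\<close>

lemma length_stage: "w \<in> stage m k \<Longrightarrow> m < length w"
proof -
  assume w: "w \<in> stage m k"
  have "length ws \<le> length (concat ws)" if "ws \<in> lists (gen_words i)" for ws i
    using that
  proof induction
    case (Cons a ws)
    have "1 \<le> length a" using Cons.hyps(1) by (auto simp: gen_words_def)
    then show ?case using Cons.IH by simp
  qed simp
  then have "Suc m \<le> length (concat ws)" if "ws \<in> lists (gen_words i)" "length ws = Suc m" for ws i
    using that by metis
  moreover have "m < 2 ^ Suc m" using less_exp[of "Suc m"] by linarith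
  ultimately show ?thesis using w by (auto simp: stage_def Suc_le_eq split: if_splits)
qed

lemma stage_subset_lists: "2 \<le> n \<Longrightarrow> stage m k \<subseteq> lists {..<n}"
  by (auto simp: stage_def gen_words_def in_lists_conv_set split: if_splits) (fastforce)+

lemma dictionary_subset_lists: "2 \<le> n \<Longrightarrow> dictionary T r \<subseteq> lists {..<n}"
  unfolding dictionary_def by (intro insert_subsetI UN_least stage_subset_lists) auto

lemma concat_in_concat_lists:
  assumes "ws \<in> lists (concat ` lists B)" shows "concat ws \<in> concat ` lists B"
  using assms
proof induction
  case (Cons w ws)
  then obtain us vs where "us \<in> lists B" "vs \<in> lists B" "w = concat us" "concat ws = concat vs" by auto
  then show ?case by (intro image_eqI[of _ _ "us @ vs"]) auto
qed (auto intro: image_eqI[of _ _ "[]"])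

lemma zeros_in_gen_words_concat:
  assumes "i \<le> j" shows "replicate (2 ^ j) 0 \<in> concat ` lists (gen_words i)"
proof (rule image_eqI)
  have "concat (replicate k (replicate d (0 :: nat))) = replicate (k * d) 0" for k d
    by (induction k) (simp_all add: replicate_add)
  from this[of "2 ^ (j - i)" "2 ^ i"]
  show "replicate (2 ^ j) (0 :: nat) = concat (replicate (2 ^ (j - i)) (replicate (2 ^ i) 0))"
    using assms by (simp flip: power_add)
  show "replicate (2 ^ (j - i)) (replicate (2 ^ i) 0) \<in> lists (gen_words i)"
    by (simp add: gen_words_def in_lists_conv_set)
qed

lemma stage_subset_concat_gen_words:
  assumes "2 * i \<le> k" "k \<le> m"
  shows "stage m k \<subseteq> concat ` lists (gen_words i)"
proof
  fix w assume w: "w \<in> stage m k"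
  have i: "i \<le> k div 2" "i \<le> Suc m" using assms by auto
  have one: "[1] \<in> concat ` lists (gen_words i)"
    using subset_concat_lists unfolding gen_words_def by blast
  have "\<exists>ws. ws \<in> lists (concat ` lists (gen_words i)) \<and> w = concat ws"
  proof (cases "even k")
    case True
    have "gen_words (k div 2) \<subseteq> concat ` lists (gen_words i)"
      using one zeros_in_gen_words_concat[OF i(1)] unfolding gen_words_def[of "k div 2"] by blast
    then show ?thesis using w True unfolding stage_def by (auto simp: in_lists_conv_set)
  next
    case False
    have "replicate m 1 = concat (replicate m [1 :: nat])" by (induction m) auto
    then consider "w = concat (replicate m [1] @ [replicate (2 ^ (k div 2)) 0])" | "w = concat [replicate (2 ^ Suc m) 0]"
      using w False unfolding stage_def by auto
    then show ?thesis
    proof cases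
      case 1
      have "replicate m [1] @ [replicate (2 ^ (k div 2)) 0] \<in> lists (concat ` lists (gen_words i))"
        using one zeros_in_gen_words_concat[OF i(1)] by (simp add: in_lists_conv_set) 
      then show ?thesis using 1 by blast
    next
      case 2
      have "[replicate (2 ^ Suc m) 0] \<in> lists (concat ` lists (gen_words i))"
        using zeros_in_gen_words_concat[OF i(2)] by simp
      then show ?thesis using 2 by blast
    qed
  qed
  then show "w \<in> concat ` lists (gen_words i)" using concat_in_concat_lists by blast
qed

lemma omega_power_take_factors:
  assumes "x \<in> omega_power B"
  shows "\<exists>ws y. ws \<in> lists (B - {[]}) \<and> length ws = n \<and> y \<in> omega_power B \<and> x = concat ws \<frown> y"
  using assms
proof (induction n arbitrary: x)
  case (Suc n)
  obtain b x' where b: "b \<in> B" "b \<noteq> []" "x' \<in> omega_power B" "x = b \<frown> x'"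
    using omega_power_cases[OF Suc.prems] by blast
  obtain ws y where "ws \<in> lists (B - {[]})" "length ws = n" "y \<in> omega_power B" "x' = concat ws \<frown> y"
    using Suc.IH[OF b(3)] by blast
  then show ?case using b by (intro exI[of _ "b # ws"] exI[of _ y]) auto
qed auto

text \<open>All words come from \<open>gen_words i\<close>, because \<open>2^i\<close> divides \<open>2^j\<close> for \<open>i \<le> j\<close>. Conversely, one step
  \<open>N\<close> at the value \<open>2 * i\<close> provides all products of exactly \<open>Suc N\<close> generators, and every point of
  the \<open>\<omega>\<close>-power splits into blocks of that many factors.\<close>

lemma even_dictionary_in_G2:
  assumes n: "2 \<le> n" and d: "descends T r (2 * i)"
  shows "dictionary T r \<in> G2 n"
proof -
  have "stage m (r m) \<subseteq> concat ` lists (gen_words i)" if "m \<in> T" for m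
    using stage_subset_concat_gen_words descends_limit_le[OF d that] d that unfolding descends_def by blast
  moreover have "[1] \<in> concat ` lists (gen_words i)"
    using subset_concat_lists unfolding gen_words_def by blast
  ultimately have "omega_power (dictionary T r) \<subseteq> omega_power (gen_words i)"
    unfolding dictionary_def by (intro omega_power_mono_concat) auto
  moreover have "omega_power (gen_words i) \<subseteq> omega_power (dictionary T r)"
  proof
    obtain N where N: "N \<in> T" "r N = 2 * i" using d unfolding descends_def by blast
    fix x assume "x \<in> omega_power (gen_words i)"
    then show "x \<in> omega_power (dictionary T r)"
    proof (rule omega_power_coinduct)
      fix x assume x: "x \<in> omega_power (gen_words i)"
      obtain ws y where ws: "ws \<in> lists (gen_words i - {[]})" "length ws = Suc N"
          "y \<in> omega_power (gen_words i)" "x = concat ws \<frown> y"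
        using omega_power_take_factors[OF x, of "Suc N"] by blast
      have "ws \<in> lists (gen_words i)" using ws(1) by auto
      then have "concat ws \<in> stage N (r N)" using ws(2) N(2) by (auto simp: stage_def)
      moreover from this have "concat ws \<noteq> []" using length_stage by fastforce
      ultimately show "\<exists>a\<in>dictionary T r. a \<noteq> [] \<and> (\<exists>y\<in>omega_power (gen_words i). x = a \<frown> y)"
        using ws(3,4) N(1) unfolding dictionary_def by blast
    qed
  qed
  ultimately have "omega_power (dictionary T r) = omega_power {replicate (2 ^ i) 0, [1]}"
    unfolding gen_words_def by blast
  moreover have "replicate (2 ^ i) 0 \<in> lists {..<n}" "[1] \<in> lists {..<n}"
    using n by (auto simp: in_lists_conv_set)
  ultimately show ?thesis using dictionary_subset_lists[OF n] unfolding G2_def by blast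
qed

lemma generator_is_zeros:
  assumes "replicate k (0 :: nat) \<in> concat ` lists {[1], w}" "0 < k"
  shows "\<exists>d. w = replicate d 0"
proof -
  obtain ws where ws: "ws \<in> lists {[1], w}" "concat ws = replicate k 0"
    using assms(1) by (metis imageE)
  have letters: "set v \<subseteq> {0}" if "v \<in> set ws" for v
    using arg_cong[OF ws(2), of set] that by (auto split: if_splits)
  have "w \<in> set ws"
  proof (rule ccontr)
    assume "w \<notin> set ws"
    then have "set ws \<subseteq> {[1]}" using ws(1) by auto
    moreover have "[1] \<notin> set ws" using letters[of "[1]"] by auto
    ultimately have "set ws = {}" by (metis subset_singletonD insertI1)
    then show False using ws(2) assms(2) by simp
  qed
  then have "\<forall>x\<in>set w. x = 0" using letters by blast
  then show ?thesis using replicate_length_same[of w 0] by metis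
qed

lemma count_zeros_dvd:
  assumes "w \<in> concat ` lists {[1 :: nat], replicate d 0}"
  shows "d dvd length (filter ((=) 0) w)"
proof -
  obtain ws where ws: "ws \<in> lists {[1 :: nat], replicate d 0}" "w = concat ws" using assms by auto
  show ?thesis unfolding ws(2) using ws(1) by induction auto
qed

text \<open>Suppose that \<open>{u, v}\<close> has the same \<open>\<omega>\<close>-power. Then \<open>u\<close> and \<open>v\<close> generate all words. As \<open>1\<close> is
  among them, one generator is \<open>1\<close>; because of \<open>0^(2^(N + 1))\<close> the other one is \<open>0^d\<close>; and \<open>d\<close>
  divides \<open>2^i\<close> because of \<open>1^N 0^(2^i)\<close>. So \<open>0^(2^i) 1 1 1 \<dots>\<close> is in the \<open>\<omega>\<close>-power. But
  every word of the dictionary starts either with \<open>1\<close> or with more than \<open>2^i\<close> zeros.\<close>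

lemma odd_dictionary_notin_G2:
  assumes n: "2 \<le> n" and d: "descends T r (2 * i + 1)"
  shows "dictionary T r \<notin> G2 n"
proof
  let ?A = "dictionary T r" and ?ones = "\<lambda>_::nat. 1::nat"
  assume G2: "?A \<in> G2 n"
  obtain N where N: "N \<in> T" "r N = 2 * i + 1" "r N \<le> N" using d unfolding descends_def by blast
  then have stage_N: "stage N (2 * i + 1) \<subseteq> ?A" unfolding dictionary_def by force
  then have zeros: "replicate (2 ^ Suc N) 0 \<in> ?A" and mixed: "replicate N 1 @ replicate (2 ^ i) 0 \<in> ?A"
    unfolding stage_def by simp_all
  have one: "[1] \<in> ?A" by (simp add: dictionary_def)
  have "\<not> commuting ?A"
  proof
    assume "commuting ?A"
    then have "replicate (2 ^ Suc N) 0 @ [1] = [1] @ replicate (2 ^ Suc N) (0 :: nat)"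
      using zeros one unfolding commuting_def by blast
    then have "(replicate (2 ^ Suc N) 0 @ [1]) ! 0 = ([1] @ replicate (2 ^ Suc N) (0 :: nat)) ! 0" by metis
    then show False by (simp add: nth_append)
  qed
  then obtain u v where uv: "?A \<subseteq> concat ` lists {u, v}" "omega_power ?A = omega_power {u, v}"
    using noncommuting_in_G2_iff[OF dictionary_subset_lists[OF n, of T r]] G2 generatorsD[of _ _ n ?A] by blast
  obtain ws where ws: "ws \<in> lists {u, v}" "concat ws = [1]" using uv(1) one by force
  have "\<exists>x\<in>set ws. x = [1]" using ws(2) by (induction ws) (auto simp: append_eq_Cons_conv)
  then have "[1] \<in> {u, v}" using ws(1) by auto
  then obtain w where w: "{u, v} = {[1], w}" by blast
  obtain d where d0: "w = replicate d 0"
    using generator_is_zeros[of "2 ^ Suc N" w] uv(1) zeros unfolding w by auto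
  have "d dvd 2 ^ i"
    using count_zeros_dvd[of "replicate N 1 @ replicate (2 ^ i) 0" d] uv(1) mixed unfolding w d0 by auto
  then obtain q where q: "2 ^ i = d * q" by blast
  have "?ones \<in> omega_power {u, v}"
    by (rule omega_power_coinduct[of _ "{?ones}"])
      (auto simp: w conc_def fun_eq_iff intro!: bexI[of _ "[1]"])
  moreover have "replicate (2 ^ i) 0 \<in> concat ` lists {u, v}"
  proof (rule image_eqI)
    show "replicate (2 ^ i) 0 = concat (replicate q w)"
      unfolding q d0 by (induction q) (simp_all add: replicate_add algebra_simps)
  qed (auto simp: w in_lists_conv_set)
  ultimately have "replicate (2 ^ i) 0 \<frown> ?ones \<in> omega_power ?A"
    unfolding uv(2) by (rule concat_conc_in_omega_power[rotated])
  then obtain a y where a: "a \<in> ?A" "a \<noteq> []" "replicate (2 ^ i) 0 \<frown> ?ones = a \<frown> y"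
    by (rule omega_power_cases)
  have "a ! 0 = 1 \<or> (2 ^ i < length a \<and> a ! (2 ^ i) = 0)"
  proof (cases "a = [1]")
    case False
    then obtain m where m: "m \<in> T" "a \<in> stage m (r m)" using a(1) by (auto simp: dictionary_def)
    have k: "2 * i + 1 \<le> r m" "r m \<le> m"
      using descends_limit_le[OF d m(1)] d m(1) by (auto simp: descends_def)
    have pow: "(2 :: nat) ^ i < 2 ^ j" if "i < j" for j using that by simp
    show ?thesis
    proof (cases "even (r m)")
      case True
      then obtain ws where ws: "ws \<in> lists (gen_words (r m div 2))" "length ws = Suc m" "a = concat ws"
        using m(2) by (auto simp: stage_def)
      then obtain b ws' where "ws = b # ws'" by (cases ws) auto
      moreover have "i < r m div 2" using k(1) True by presburger
      ultimately show ?thesis using ws pow[of "r m div 2"] by (auto simp: gen_words_def nth_append)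
    next
      case False
      then have "a = replicate m 1 @ replicate (2 ^ (r m div 2)) 0 \<or> a = replicate (2 ^ Suc m) 0"
        using m(2) by (simp add: stage_def)
      moreover have "i < Suc m" "0 < m" using k by linarith+
      ultimately show ?thesis using pow[of "Suc m"] by (auto simp: nth_append)
    qed
  qed simp
  moreover have "a ! 0 = 0"
    using fun_cong[OF a(3), of 0] a(2) by simp
  moreover have "a ! (2 ^ i) = 1" if "2 ^ i < length a"
    using fun_cong[OF a(3), of "2 ^ i"] that by simp
  ultimately show False by auto
qed

lemma dictionary_in_G2_iff:
  assumes "2 \<le> n" "descends T r l"
  shows "dictionary T r \<in> G2 n \<longleftrightarrow> even l"
proof (cases "even l")
  case True
  then show ?thesis using even_dictionary_in_G2[of n T r "l div 2"] assms by simp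
next
  case False
  then show ?thesis using odd_dictionary_notin_G2[of n T r "l div 2"] assms by simp
qed

lemma empty_dictionary_in_G2: "2 \<le> n \<Longrightarrow> dictionary {} r \<in> G2 n"
  by (rule commuting_in_G2[OF dictionary_subset_lists]) (auto simp: dictionary_def commuting_def)

section \<open>Strictness\<close>

lemma D_omegaE:
  assumes "S \<in> D_omega X"
  obtains V :: "nat \<Rightarrow> 'a set" where "\<And>k. openin X (V k)"
    "\<And>x. x \<in> S \<longleftrightarrow> (\<exists>k. odd k \<and> x \<in> V k \<and> (\<forall>j<k. x \<notin> V j))"
proof -
  obtain V :: "nat \<Rightarrow> 'a set"
    where "S = (\<Union>k\<in>{k. odd k}. V k - (\<Union>j<k. V j)) \<and> incseq V \<and> (\<forall>k. openin X (V k))"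
    using assms unfolding D_omega_def mem_Collect_eq by (rule exE)
  then show thesis by (intro that[of V]) auto
qed

text \<open>By parity, the least index \<open>k\<close> of the dictionary is not \<open>l\<close>. If it were below \<open>l\<close>, one could let the
  sequence fall to \<open>l - 1\<close> so late that the new dictionary stays in the open set \<open>V k\<close>, although
  \<open>k \<le> l - 1\<close>.\<close>

lemma dictionary_notin_V:
  assumes n: "2 \<le> n" and V: "\<And>k. openin (powerset_topology (lists {..<n})) (V k)"
    and G2: "\<And>A. A \<in> G2 n \<longleftrightarrow> (\<exists>k. odd k \<and> A \<in> V k \<and> (\<forall>j<k. A \<notin> V j))"
    and "descends T r l" "j \<le> l"
  shows "dictionary T r \<notin> V j"
  using assms(4,5)
proof (induction l arbitrary: r j rule: less_induct)
  case (less l)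
  show ?case
  proof
    assume "dictionary T r \<in> V j"
    define k where "k = (LEAST k. dictionary T r \<in> V k)"
    have k: "dictionary T r \<in> V k" "k \<le> j" "\<And>i. i < k \<Longrightarrow> dictionary T r \<notin> V i"
      unfolding k_def using \<open>dictionary T r \<in> V j\<close> by (auto intro: LeastI Least_le dest: not_less_Least)
    have "dictionary T r \<in> G2 n \<longleftrightarrow> odd k"
      unfolding G2 using k by (metis linorder_neqE_nat)
    then have "k \<noteq> l" using dictionary_in_G2_iff[OF n less.prems(1)] by auto
    with k(2) less.prems(2) have "k < l" by simp
    obtain E where E: "finite E" "\<And>B. B \<subseteq> lists {..<n} \<Longrightarrow> B \<inter> E = dictionary T r \<inter> E \<Longrightarrow> B \<in> V k"
      using openin_powerset_topologyE[OF V k(1)] by metis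
    obtain N where N: "N \<in> T" "\<forall>m\<ge>N. r m = l" using less.prems(1) by (auto simp: descends_def)
    define M where "M = Max (insert N (length ` E))"
    have M: "N \<le> M" "\<And>w. w \<in> E \<Longrightarrow> length w \<le> M" using E(1) by (auto simp: M_def)
    define r' where "r' m = (if m < M then r m else l - 1)" for m
    have "descends T r' (l - 1)"
      unfolding descends_def
    proof (intro conjI ballI allI impI)
      fix m assume m: "m \<in> T"
      have lr: "l \<le> r m" "r m \<le> m" using descends_limit_le less.prems(1) m by (auto simp: descends_def)
      then show "r' m \<le> m" by (auto simp: r'_def)
      fix m' assume "m \<le> m'"
      then show "m' \<in> T" "r' m' \<le> r' m"
        using less.prems(1) m lr by (auto simp: r'_def descends_def)
    next
      have "M \<in> T" using less.prems(1) N(1) M(1) by (auto simp: descends_def)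
      then show "\<exists>N\<in>T. \<forall>m\<ge>N. r' m = l - 1" by (intro bexI[of _ M]) (simp_all add: r'_def)
    qed
    moreover have "l - 1 < l" "k \<le> l - 1" using \<open>k < l\<close> by auto
    ultimately have "dictionary T r' \<notin> V k" using less.IH by blast
    moreover have "w \<in> dictionary T r' \<longleftrightarrow> w \<in> dictionary T r" if "w \<in> E" for w
    proof -
      have "w \<in> stage m (r' m) \<longleftrightarrow> w \<in> stage m (r m)" for m
      proof (cases "m < M")
        case False
        then have "w \<notin> stage m k" for k using length_stage[of w m k] M(2)[OF that] by linarith
        then show ?thesis by simp
      qed (simp add: r'_def)
      then show ?thesis by (simp add: dictionary_def)
    qed
    then have "dictionary T r' \<inter> E = dictionary T r \<inter> E" by blast
    then have "dictionary T r' \<in> V k" by (rule E(2)[OF dictionary_subset_lists[OF n]])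
    ultimately show False by contradiction
  qed
qed

text \<open>The dictionary \<open>{1}\<close> is in \<open>G2\<close> and so has an index \<open>k\<close>. A dictionary with the constant value \<open>k\<close>
  that starts late enough is still in \<open>V k\<close>, which \<open>dictionary_notin_V\<close> excludes.\<close>

lemma G2_notin_D_omega:
  assumes n: "2 \<le> n"
  shows "G2 n \<notin> D_omega (powerset_topology (lists {..<n}))"
proof
  assume "G2 n \<in> D_omega (powerset_topology (lists {..<n}))"
  then obtain V :: "nat \<Rightarrow> nat list set set"
    where V: "\<And>k. openin (powerset_topology (lists {..<n})) (V k)"
      and G2: "\<And>A. A \<in> G2 n \<longleftrightarrow> (\<exists>k. odd k \<and> A \<in> V k \<and> (\<forall>j<k. A \<notin> V j))"
    by (rule D_omegaE) (rule that)
  obtain k where k: "dictionary {} id \<in> V k"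
    using empty_dictionary_in_G2[OF n, of id] unfolding G2 by blast
  obtain E where E: "finite E" "\<And>B. B \<subseteq> lists {..<n} \<Longrightarrow> B \<inter> E = dictionary {} id \<inter> E \<Longrightarrow> B \<in> V k"
    using openin_powerset_topologyE[OF V k] by metis
  \<comment> \<open>The step \<open>M\<close> bounds \<open>k\<close>, as a descending sequence requires, and the words that \<open>E\<close> can see.\<close>
  define M where "M = Max (insert k (length ` E))"
  have M: "k \<le> M" "\<And>w. w \<in> E \<Longrightarrow> length w \<le> M" using E(1) by (auto simp: M_def)
  have "w \<in> dictionary {M..} (\<lambda>_. k) \<longleftrightarrow> w \<in> dictionary {} id" if "w \<in> E" for w
    using length_stage[of w] M(2)[OF that] by (fastforce simp: dictionary_def)
  then have "dictionary {M..} (\<lambda>_. k) \<inter> E = dictionary {} id \<inter> E" by blast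
  then have "dictionary {M..} (\<lambda>_. k) \<in> V k" by (rule E(2)[OF dictionary_subset_lists[OF n]])
  moreover have "descends {M..} (\<lambda>_. k) k" using M(1) by (auto simp: descends_def)
  ultimately show False using dictionary_notin_V[OF n V G2] by blast
qed

section \<open>Hardness\<close>

text \<open>Balls of radius \<open>1/(n + 1)\<close> around the points of a countable dense set form a countable base. For each of them
  that fits into a clopen subset of \<open>U\<close>, choose one such subset; the finite unions of the chosen sets
  give \<open>C\<close>.\<close>

lemma open_eq_Union_clopen:
  assumes Y: "zero_dim_polish Y" and U: "openin Y U"
  obtains C :: "nat \<Rightarrow> 'a set"
  where "incseq C" "\<And>m. openin Y (C m)" "\<And>m. closedin Y (C m)" "(\<Union>m. C m) = U"
proof -
  obtain M d where "Metric_space M d" and Y_eq: "Y = Metric_space.mtopology M d"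
    using Y unfolding zero_dim_polish_def completely_metrizable_space_def by blast
  interpret Metric_space M d by fact
  obtain D where D: "countable D" "D \<subseteq> M" "mtopology closure_of D = M"
    using Y unfolding zero_dim_polish_def Y_eq separable_space_def by auto
  define clopen where "clopen W \<longleftrightarrow> openin Y W \<and> closedin Y W" for W
  define \<B> where "\<B> = {(c, n :: nat). c \<in> D \<and> (\<exists>W. clopen W \<and> W \<subseteq> U \<and> mball c (inverse (Suc n)) \<subseteq> W)}"
  have "\<forall>p\<in>\<B>. \<exists>W. clopen W \<and> W \<subseteq> U \<and> mball (fst p) (inverse (Suc (snd p))) \<subseteq> W"
    unfolding \<B>_def by auto
  from bchoice[OF this] obtain W where
    W: "\<And>p. p \<in> \<B> \<Longrightarrow> clopen (W p) \<and> W p \<subseteq> U \<and> mball (fst p) (inverse (Suc (snd p))) \<subseteq> W p"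
    by blast
  have "countable \<B>"
    by (rule countable_subset[of _ "D \<times> UNIV"]) (auto simp: \<B>_def D(1))
  have "\<exists>p\<in>\<B>. x \<in> W p" if "x \<in> U" for x
  proof -
    have "neighbourhood_base_of (\<lambda>W. closedin Y W \<and> openin Y W) Y"
      using Y unfolding zero_dim_polish_def dimension_le_0_neighbourhood_base_of_clopen by blast
    then obtain S G where "x \<in> S" "S \<subseteq> G" "clopen G" and G_U: "G \<subseteq> U"
      using U \<open>x \<in> U\<close> unfolding neighbourhood_base_of clopen_def by metis
    then have G: "clopen G" "x \<in> G" "G \<subseteq> U" by auto
    have "openin mtopology G" using G(1) by (simp add: clopen_def Y_eq)
    then obtain e where e: "0 < e" "mball x e \<subseteq> G" and "x \<in> M"
      using G(2) unfolding openin_mtopology by blast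
    obtain n where n: "inverse (real (Suc n)) < e / 2" using e(1) reals_Archimedean[of "e / 2"] by auto
    have "x \<in> mball x (inverse (Suc n))" using \<open>x \<in> M\<close> by simp
    then obtain c where c: "c \<in> D" "c \<in> mball x (inverse (Suc n))"
      using D(3) \<open>x \<in> M\<close> openin_mball unfolding set_eq_iff in_closure_of by (metis topspace_mtopology)
    have "mball c (inverse (Suc n)) \<subseteq> mball x e"
    proof
      fix y assume y: "y \<in> mball c (inverse (Suc n))"
      then have "d x y \<le> d x c + d c y" using c(2) by (intro triangle) auto
      also have "\<dots> < e" using y c(2) n by auto
      finally show "y \<in> mball x e" using y \<open>x \<in> M\<close> by auto
    qed
    then have "(c, n) \<in> \<B>" unfolding \<B>_def using G e(2) c(1) by auto
    moreover have "x \<in> mball c (inverse (Suc n))" using c(2) by (simp add: commute)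
    ultimately show ?thesis using W[of "(c, n)"] by (intro bexI[of _ "(c, n)"]) auto
  qed
  then have U_eq: "(\<Union>p\<in>\<B>. W p) = U" using W by blast
  define C where "C m = \<Union>(W ` {p \<in> \<B>. to_nat_on \<B> p < m})" for m
  have fin: "finite {p \<in> \<B>. to_nat_on \<B> p < m}" for m
    by (rule finite_imageD[of "to_nat_on \<B>"])
      (auto intro: finite_subset[of _ "{..<m}"] inj_on_subset[OF inj_on_to_nat_on[OF \<open>countable \<B>\<close>]])
  show thesis
  proof
    show "incseq C" unfolding incseq_def C_def using less_le_trans by blast
    show "openin Y (C m)" for m unfolding C_def using W by (auto simp: clopen_def)
    show "closedin Y (C m)" for m unfolding C_def using W fin by (intro closedin_Union) (auto simp: clopen_def)
    show "(\<Union>m. C m) = U" unfolding C_def U_eq[symmetric] by auto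
  qed
qed

text \<open>At step \<open>m\<close>, the value \<open>r y m\<close> is the least \<open>k\<close> for which \<open>y \<in> V k\<close> has been observed. It converges to the least \<open>k\<close>
  with \<open>y \<in> V k\<close>, and whether it equals \<open>k\<close> is a clopen condition on \<open>y\<close>.\<close>

lemma G2_hard:
  assumes n: "2 \<le> n" and Y: "zero_dim_polish Y" and B: "B \<in> co_D_omega Y"
  shows "\<exists>f. continuous_map Y (powerset_topology (lists {..<n})) f \<and> B = {y \<in> topspace Y. f y \<in> G2 n}"
proof -
  obtain S where S: "S \<in> D_omega Y" and B_eq: "B = topspace Y - S"
    using B unfolding co_D_omega_def by blast
  obtain V :: "nat \<Rightarrow> 'a set" where V: "\<And>k. openin Y (V k)"
    and S_iff: "\<And>y. y \<in> S \<longleftrightarrow> (\<exists>k. odd k \<and> y \<in> V k \<and> (\<forall>j<k. y \<notin> V j))"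
    using S by (rule D_omegaE) (rule that)
  have "\<exists>C :: nat \<Rightarrow> 'a set. incseq C \<and> (\<forall>m. openin Y (C m) \<and> closedin Y (C m)) \<and> (\<Union>m. C m) = V k" for k
    using open_eq_Union_clopen[OF Y V[of k]] by metis
  then obtain C where C: "\<And>k. incseq (C k)" "\<And>k m. openin Y (C k m)" "\<And>k m. closedin Y (C k m)"
      "\<And>k. (\<Union>m. C k m) = V k" by metis
  have C_mono: "y \<in> C k m'" if "y \<in> C k m" "m \<le> m'" for y k m m'
    using C(1)[of k] that by (auto simp: incseq_def)
  define T where "T y = {m. \<exists>k\<le>m. y \<in> C k m}" for y
  define r where "r y m = (LEAST k. y \<in> C k m)" for y m
  define f where "f y = dictionary (T y) (r y)" for y
  have r: "y \<in> C (r y m) m" "r y m \<le> m" if "m \<in> T y" for y m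
  proof -
    obtain k where k: "k \<le> m" "y \<in> C k m" using \<open>m \<in> T y\<close> by (auto simp: T_def)
    show "y \<in> C (r y m) m" unfolding r_def using k(2) by (rule LeastI)
    have "r y m \<le> k" unfolding r_def using k(2) by (rule Least_le)
    then show "r y m \<le> m" using k(1) by simp
  qed
  have "B = {y \<in> topspace Y. f y \<in> G2 n}"
  proof -
    have "y \<in> S \<longleftrightarrow> f y \<notin> G2 n" for y
    proof (cases "\<exists>k. y \<in> V k")
      case False
      then have "y \<notin> C k m" for k m using C(4)[of k] by blast
      then have "T y = {}" by (simp add: T_def)
      then show ?thesis using False empty_dictionary_in_G2[OF n] by (simp add: f_def S_iff)
    next
      case True
      define l where "l = (LEAST k. y \<in> V k)"
      have l: "y \<in> V l" "\<And>k. k < l \<Longrightarrow> y \<notin> V k"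
        unfolding l_def using True by (auto intro: LeastI_ex dest: not_less_Least)
      obtain m0 where m0: "y \<in> C l m0" using l(1) C(4) by blast
      have limit: "r y m = l" if "max l m0 \<le> m" for m
        unfolding r_def
      proof (rule Least_equality)
        show "y \<in> C l m" using C_mono[OF m0] that by simp
        show "l \<le> k" if "y \<in> C k m" for k using that C(4) l(2) by (metis UN_I UNIV_I not_le_imp_less)
      qed
      have "descends (T y) (r y) l"
        unfolding descends_def
      proof (intro conjI ballI allI impI)
        fix m assume m: "m \<in> T y"
        show "r y m \<le> m" using r(2)[OF m] .
        fix m' assume "m \<le> m'"
        then have *: "y \<in> C (r y m) m'" using r(1)[OF m] C_mono by blast
        then show "m' \<in> T y" using le_trans[OF r(2)[OF m] \<open>m \<le> m'\<close>] unfolding T_def by blast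
        show "r y m' \<le> r y m" unfolding r_def[of y m'] using * by (rule Least_le)
      next
        have "max l m0 \<in> T y" unfolding T_def using C_mono[OF m0] by (auto intro!: exI[of _ l])
        then show "\<exists>N\<in>T y. \<forall>m\<ge>N. r y m = l" using limit by blast
      qed
      then have "f y \<in> G2 n \<longleftrightarrow> even l" unfolding f_def by (rule dictionary_in_G2_iff[OF n])
      moreover have "y \<in> S \<longleftrightarrow> odd l"
        unfolding S_iff using l by (metis linorder_neqE_nat)
      ultimately show ?thesis by blast
    qed
    then show ?thesis unfolding B_eq by blast
  qed
  moreover have "continuous_map Y (powerset_topology (lists {..<n})) f"
  proof (rule continuous_map_into_powerset_topology)
    show "f y \<subseteq> lists {..<n}" for y unfolding f_def by (rule dictionary_subset_lists[OF n])
    fix s :: "nat list"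
    define K where "K = (\<Union>m<length s. \<Union>k\<in>{k. k \<le> m \<and> s \<in> stage m k}. C k m - (\<Union>j<k. C j m))"
    have diff: "openin Y (C k m - (\<Union>j<k. C j m))" "closedin Y (C k m - (\<Union>j<k. C j m))" for k m
      using C(2,3) by (auto intro!: openin_diff closedin_diff closedin_Union)
    have "openin Y K" unfolding K_def using diff(1) by (intro openin_Union) auto
    moreover have "closedin Y K" unfolding K_def using diff(2) by (auto intro!: closedin_Union)
    moreover have f_iff: "s \<in> f y \<longleftrightarrow> s = [1] \<or> y \<in> K" for y
    proof -
      have "(\<exists>m\<in>T y. s \<in> stage m (r y m)) \<longleftrightarrow> y \<in> K"
      proof
        assume "\<exists>m\<in>T y. s \<in> stage m (r y m)"
        then obtain m where m: "m \<in> T y" "s \<in> stage m (r y m)" by blast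
        have "y \<in> C (r y m) m - (\<Union>j<r y m. C j m)"
          using r(1)[OF m(1)] by (auto simp: r_def dest: not_less_Least)
        then show "y \<in> K" unfolding K_def using r(2)[OF m(1)] m(2) length_stage by blast
      next
        assume "y \<in> K"
        then obtain m k where k: "k \<le> m" "s \<in> stage m k" "y \<in> C k m" "\<And>j. j < k \<Longrightarrow> y \<notin> C j m"
          unfolding K_def by blast
        have "r y m = k" unfolding r_def using k(3,4) by (intro Least_equality) (auto simp flip: not_less)
        moreover have "m \<in> T y" using k(1,3) by (auto simp: T_def)
        ultimately show "\<exists>m\<in>T y. s \<in> stage m (r y m)" using k(2) by blast
      qed
      then show ?thesis by (auto simp: f_def dictionary_def)
    qed
    ultimately have K: "openin Y K" "openin Y (topspace Y - K)" by auto
    have "{y \<in> topspace Y. s \<in> f y} = (if s = [1] then topspace Y else K)"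
      using f_iff openin_subset[OF K(1)] by auto
    then show "openin Y {y \<in> topspace Y. s \<in> f y}" using K(1) by simp
    have "{y \<in> topspace Y. s \<notin> f y} = (if s = [1] then {} else topspace Y - K)"
      using f_iff by auto
    then show "openin Y {y \<in> topspace Y. s \<notin> f y}" using K(2) by simp
  qed
  ultimately show ?thesis by blast
qed

theorem corollary10:
  fixes n :: nat
  assumes "n \<ge> 2"
  shows "G2 n \<in> co_D_omega (powerset_topology (lists {..<n})) - D_omega (powerset_topology (lists {..<n}))
    \<and> class_complete co_D_omega (co_D_omega :: 'b topology \<Rightarrow> 'b set set)
         (powerset_topology (lists {..<n})) (G2 n)"
proof -
  have "zero_dim_polish (powerset_topology (lists {..<n}))"
    by (rule zero_dim_polish_powerset_topology) simp
  then show ?thesis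
    using G2_in_co_D_omega G2_notin_D_omega[OF assms] G2_hard[OF assms]
    unfolding class_complete_def by blast
qed

end
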